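(* There exists a pair of compact metrizable spaces, each with the $\mathcal{AF}$-property, such that their product does not have the $\mathcal{AF}$-property.
   Context: For a metrizable space $X$, a continuous map $f\colon X\to X$ and a point $x\in X$, the $\alpha$-limit set of $x$ is $\alpha_f(x)=\bigcap_{n\ge 0}\overline{\bigcup_{k\ge n} f^{-k}(x)}$, where $f^{-k}(x)=\{y\in X: f^k(y)=x\}$. A set $A\subseteq X$ is an $\alpha$-limit set in $X$ if $A=\alpha_f(x)$ for some continuous $f\colon X\to X$ and some $x\in X$. A metrizable space $X$ has the $\mathcal{AF}$-property if the $\alpha$-limit sets in $X$ are precisely the closed subsets of $X$ (including $\emptyset$ and $X$). Products carry the product topology. *)

theory Defs
  imports "HOL-Analysis.Analysis"
begin

text \<open>
  Spaces are abstract topologies \<open>X\<close> with carrier \<open>topspace X\<close>; the values of a self-map outside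
  the carrier are irrelevant, because a continuous map sends \<open>topspace X\<close> into itself and only
  points of the carrier enter the iterated preimages.

  Every compact metrizable space is homeomorphic to a subspace of the Hilbert cube, so topologies
  on the type \<open>nat \<Rightarrow> real\<close> (with arbitrary carrier) represent all of them.
\<close>

definition iter_preimage :: "'a topology \<Rightarrow> ('a \<Rightarrow> 'a) \<Rightarrow> nat \<Rightarrow> 'a \<Rightarrow> 'a set"
  where "iter_preimage X f k x = {y \<in> topspace X. (f ^^ k) y = x}"

definition alpha_limit :: "'a topology \<Rightarrow> ('a \<Rightarrow> 'a) \<Rightarrow> 'a \<Rightarrow> 'a set"
  where "alpha_limit X f x = (\<Inter>n. X closure_of (\<Union>k\<in>{n..}. iter_preimage X f k x))"

definition is_alpha_limit_set :: "'a topology \<Rightarrow> 'a set \<Rightarrow> bool"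
  where "is_alpha_limit_set X A \<longleftrightarrow>
    (\<exists>f x. continuous_map X X f \<and> x \<in> topspace X \<and> A = alpha_limit X f x)"

text \<open>Meant for metrizable \<open>X\<close>; metrizability is stated separately wherever it is required.\<close>

definition AF_property :: "'a topology \<Rightarrow> bool"
  where "AF_property X \<longleftrightarrow> {A. is_alpha_limit_set X A} = {A. closedin X A}"

end

theory Submission
  imports Defs
begin

text \<open>
  Each of the two spaces consists of an isolated point and of a compactified ray. The ray is the curve
  \<open>u \<mapsto> (1 / u, h u)\<close>, and its remainder is \<open>{0} \<times> B\<close>, where \<open>B\<close> is the set of limit values of \<open>h\<close>.
  In the first space \<open>h\<close> winds around a circle (\<open>cis\<close>), in the second one it oscillates in an arc (\<open>zig\<close>).
  As in the topologist's sine curve, no path leads from the ray to the remainder.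

  Both spaces have the \<open>AF\<close>-property (\<open>AF_property_pointed_space\<close>). If an arc leaves a closed set \<open>A\<close>
  at once, then mapping the space to this arc by the distance to \<open>A\<close> gives a map for which every
  iterated preimage of the starting point is \<open>A\<close>. The only closed sets that are neither empty nor clopen nor
  accessible in this way are the remainder and its union with the isolated point. These are limit
  sets of a map that doubles the parameter of the ray: on the circle it is squaring, on the arc it is
  an expanding piecewise linear map, and the backward orbit of a suitable fixed point is dense in the
  remainder.

  The product contains clopen copies of the two compactified rays, and the union \<open>A\<close> of
  their remainders is not a limit set (\<open>alpha_limit_not_both_remainders\<close>). If \<open>A = \<alpha>(x)\<close>, then
  \<open>x\<close> lies in one of the copies, say \<open>C1\<close>, and the other copy \<open>C2\<close> is mapped into \<open>C1\<close>, remainder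
  to remainder. There is no map between the two compactified rays, in either direction, that takes
  ray to ray and remainder to remainder; so \<open>C2\<close> is mapped into the remainder of \<open>C1\<close>. Late preimages of
  \<open>x\<close> leave every arc \<open>D\<close> in the ray of \<open>C2\<close>, hence they avoid \<open>f (f D)\<close>; but
  those in \<open>A\<close> come close to every point of \<open>f (f D)\<close>, and a nondegenerate connected subset of a circle or an arc has interior. So \<open>f \<circ> f\<close> is
  constant on \<open>C2\<close>, and the limit set would contain all of \<open>C2\<close> or nothing of it.

  It remains to see why the two rays are incomparable. A map from the arc to the circle has a bounded
  argument, so the second ray cannot follow the spiral to infinity (\<open>no_map_zigzag_to_spiral\<close>). Conversely, a
  map from the spiral behaves almost periodically, whereas \<open>zig\<close> has ever longer runs of oscillations in
  \<open>[-1, 0]\<close> between its returns to the value \<open>1\<close> (\<open>no_map_spiral_to_zigzag\<close>).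
\<close>

section \<open>Alpha-limit sets in metric spaces\<close>

text \<open>
  An intersection of closures is closed, so only the realisation of closed sets is at stake.
\<close>

lemma AF_property_iff:
  "AF_property X \<longleftrightarrow> (\<forall>A. closedin X A \<longrightarrow> is_alpha_limit_set X A)"
proof -
  have "closedin X A" if "is_alpha_limit_set X A" for A
  proof -
    from that obtain f x where "A = alpha_limit X f x"
      unfolding is_alpha_limit_set_def by blast
    then show ?thesis
      unfolding alpha_limit_def by (auto intro!: closedin_Inter)
  qed
  then show ?thesis
    unfolding AF_property_def by blast
qed

lemma funpow_mem:
  assumes "f ` S \<subseteq> S" "y \<in> S"
  shows "(f ^^ k) y \<in> S"
  using assms by (induction k) auto

lemma alpha_limit_homeomorphic_image:
  assumes "homeomorphic_maps X X' h h'" "continuous_map X X f" "x \<in> topspace X"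
  shows "alpha_limit X' (h \<circ> f \<circ> h') (h x) = h ` alpha_limit X f x"
proof -
  have hm: "homeomorphic_map X X' h"
    using assms(1) by (simp add: homeomorphic_maps_map)
  have inj: "inj_on h (topspace X)" and img: "h ` topspace X = topspace X'"
    using hm by (simp_all add: homeomorphic_eq_everything_map)
  have h'h: "h' (h y) = y" if "y \<in> topspace X" for y
    using assms(1) that by (simp add: homeomorphic_maps_def)
  have fX: "f ` topspace X \<subseteq> topspace X"
    using assms(2) by (simp add: continuous_map_image_subset_topspace)
  have it: "((h \<circ> f \<circ> h') ^^ k) (h y) = h ((f ^^ k) y)" if "y \<in> topspace X" for k y
  proof (induction k)
    case (Suc k)
    have "(f ^^ k) y \<in> topspace X"
      using funpow_mem[OF fX that] .
    then show ?case using Suc h'h by simp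
  qed simp
  have pre: "iter_preimage X' (h \<circ> f \<circ> h') k (h x) = h ` iter_preimage X f k x" (is "?L = ?R") for k
  proof -
    have "h y \<in> ?L \<longleftrightarrow> y \<in> iter_preimage X f k x" if "y \<in> topspace X" for y
      using that it[OF that, of k] img inj funpow_mem[OF fX that, of k] assms(3)
      unfolding iter_preimage_def by (auto simp: inj_on_eq_iff)
    moreover have "?L \<subseteq> h ` topspace X"
      unfolding img by (auto simp: iter_preimage_def)
    moreover have "iter_preimage X f k x \<subseteq> topspace X"
      by (auto simp: iter_preimage_def)
    ultimately show ?thesis by blast
  qed
  have sub: "(\<Union>k\<in>{n..}. iter_preimage X f k x) \<subseteq> topspace X" for n
    by (auto simp: iter_preimage_def)
  have "X' closure_of (\<Union>k\<in>{n..}. iter_preimage X' (h \<circ> f \<circ> h') k (h x))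
      = h ` (X closure_of (\<Union>k\<in>{n..}. iter_preimage X f k x))" for n
    unfolding pre image_UN[symmetric]
    using homeomorphic_map_closure_of[OF hm sub] .
  then have "alpha_limit X' (h \<circ> f \<circ> h') (h x)
      = (\<Inter>n. h ` (X closure_of (\<Union>k\<in>{n..}. iter_preimage X f k x)))"
    unfolding alpha_limit_def by simp
  also have "\<dots> = h ` alpha_limit X f x"
    unfolding alpha_limit_def
    by (rule image_INT[OF inj, symmetric]) (auto simp: closure_of_subset_topspace)
  finally show ?thesis .
qed

text \<open>
  Conjugating a self-map by a homeomorphism carries its \<open>\<alpha>\<close>-limit sets along.
\<close>

lemma AF_property_homeomorphic_space:
  assumes "X homeomorphic_space X'" "AF_property X"
  shows "AF_property X'"
  unfolding AF_property_iff
proof (intro allI impI)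
  fix A assume A: "closedin X' A"
  obtain h h' where hh: "homeomorphic_maps X X' h h'"
    using assms(1) unfolding homeomorphic_space_def by blast
  then have hh': "homeomorphic_maps X' X h' h"
    by (rule homeomorphic_maps_sym[THEN iffD1])
  have "homeomorphic_map X' X h'"
    using hh' by (simp add: homeomorphic_maps_map)
  from homeomorphic_map_closedness_eq[OF this, of A] A have "closedin X (h' ` A)"
    by blast
  then obtain f x where f: "continuous_map X X f" "x \<in> topspace X" "h' ` A = alpha_limit X f x"
    using assms(2) unfolding AF_property_iff is_alpha_limit_set_def by blast
  have "A \<subseteq> topspace X'"
    using A closedin_subset by blast
  then have "h (h' a) = a" if "a \<in> A" for a
    using hh that by (auto simp: homeomorphic_maps_def)
  then have "h ` h' ` A = A"
    by (simp add: image_image)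
  then have "A = alpha_limit X' (h \<circ> f \<circ> h') (h x)"
    using alpha_limit_homeomorphic_image[OF hh f(1,2)] f(3) by simp
  moreover have "continuous_map X' X' (h \<circ> f \<circ> h')"
    using hh f(1) unfolding homeomorphic_maps_def by (metis continuous_map_compose)
  moreover have "h x \<in> topspace X'"
    using hh f(2) continuous_map_image_subset_topspace[of X X' h]
    unfolding homeomorphic_maps_def by (metis imageI subsetD)
  ultimately show "is_alpha_limit_set X' A"
    unfolding is_alpha_limit_set_def by blast
qed

text \<open>
  In a metric space, membership says that arbitrarily late preimages of \<open>x\<close> come arbitrarily
  close to \<open>y\<close>; every later argument about \<open>\<alpha>\<close>-limit sets goes through this form.
\<close>

lemma mem_alpha_limit_top_of_set:
  fixes Z :: "'a::metric_space set"
  shows "y \<in> alpha_limit (top_of_set Z) f x \<longleftrightarrow>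
     y \<in> Z \<and> (\<forall>n. \<forall>e>0. \<exists>k\<ge>n. \<exists>z\<in>Z. (f ^^ k) z = x \<and> dist z y < e)"
proof -
  have *: "Z \<inter> (\<Union>k\<in>{n..}. iter_preimage (top_of_set Z) f k x)
      = (\<Union>k\<in>{n..}. iter_preimage (top_of_set Z) f k x)" for n
    by (auto simp: iter_preimage_def)
  show ?thesis
    unfolding alpha_limit_def closure_of_subtopology *
    by (auto simp: closure_approachable iter_preimage_def Bex_def) (metis atLeast_iff)+
qed

lemma closedin_top_of_set_closure:
  assumes "closedin (top_of_set Z) A" "y \<in> Z" "y \<in> closure A"
  shows "y \<in> A"
proof -
  obtain C where "closed C" "A = Z \<inter> C"
    using assms(1) closedin_closed by blast
  then show ?thesis
    using assms(2,3) by (metis IntI closure_minimal inf_le2 subsetD)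
qed

lemma homeomorphic_copy_in_sequences:
  fixes S :: "(real \<times> complex) set"
  assumes "compact S"
  obtains T :: "(nat \<Rightarrow> real) set" where "compact T" "top_of_set S homeomorphic_space top_of_set T"
proof -
  define i :: "real \<times> complex \<Rightarrow> nat \<Rightarrow> real" where
    "i = (\<lambda>y n. if n = 0 then fst y else if n = 1 then Re (snd y) else Im (snd y))"
  have "continuous_on S (\<lambda>y. i y n)" for n
    unfolding i_def by (cases "n = 0"; cases "n = 1") (simp_all add: continuous_intros)
  then have "continuous_on S i"
    by (rule continuous_on_coordinatewise_then_product)
  have "inj_on i S"
  proof (rule inj_onI)
    fix y z assume "i y = i z"
    then have "i y 0 = i z 0" "i y 1 = i z 1" "i y 2 = i z 2"
      by simp_all
    then show "y = z"
      by (simp add: i_def prod_eq_iff complex_eq_iff)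
  qed
  then obtain j where "homeomorphism S (i ` S) i j"
    using homeomorphism_compact[OF assms \<open>continuous_on S i\<close>] by blast
  then have "homeomorphic_maps (top_of_set S) (top_of_set (i ` S)) i j"
    by (auto simp: homeomorphism_def homeomorphic_maps_def)
  then have "top_of_set S homeomorphic_space top_of_set (i ` S)"
    unfolding homeomorphic_space_def by blast
  moreover have "compact (i ` S)"
    using \<open>continuous_on S i\<close> assms compact_continuous_image by blast
  ultimately show ?thesis using that by blast
qed

section \<open>Rays with a recurrent remainder\<close>

text \<open>
  The features of a ray \<open>S\<close> and its remainder \<open>R\<close> that the obstruction uses. The penultimate clause
  makes \<open>R\<close> inaccessible: no path passes between \<open>R\<close> and \<open>S\<close>. The last clause says that
  \<open>R\<close> is one-dimensional in the sense of an arc or a circle. All clauses are topological, so the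
  notion can be carried into a product along an isometric embedding.
\<close>

definition stratified :: "'a::metric_space set \<Rightarrow> 'a set \<Rightarrow> bool" where
  "stratified S R \<longleftrightarrow>
     S \<inter> R = {} \<and> R \<noteq> {} \<and> path_connected S \<and> R \<subseteq> closure S \<and>
     (\<forall>T. T \<subseteq> S \<union> R \<and> path_connected T \<longrightarrow> T \<subseteq> S \<or> T \<subseteq> R) \<and>
     (\<forall>E a b. E \<subseteq> R \<and> connected E \<and> a \<in> E \<and> b \<in> E \<and> a \<noteq> b \<longrightarrow>
        (\<exists>e\<in>E. \<exists>d>0. ball e d \<inter> R \<subseteq> E))"

lemma stratifiedD:
  assumes "stratified S R"
  shows "S \<inter> R = {}" "R \<noteq> {}" "path_connected S" "R \<subseteq> closure S"
  using assms unfolding stratified_def by simp_all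

lemma stratified_path_connected:
  assumes "stratified S R" "T \<subseteq> S \<union> R" "path_connected T"
  shows "T \<subseteq> S \<or> T \<subseteq> R"
  using assms unfolding stratified_def by (elim conjE allE[of _ T]) blast

lemma stratified_interior:
  assumes "stratified S R" "E \<subseteq> R" "connected E" "a \<in> E" "b \<in> E" "a \<noteq> b"
  obtains e d where "e \<in> E" "d > 0" "ball e d \<inter> R \<subseteq> E"
proof -
  have "\<forall>E a b. E \<subseteq> R \<and> connected E \<and> a \<in> E \<and> b \<in> E \<and> a \<noteq> b \<longrightarrow>
        (\<exists>e\<in>E. \<exists>d>0. ball e d \<inter> R \<subseteq> E)"
    using assms(1) unfolding stratified_def by (elim conjE)
  then show ?thesis
    using assms(2-) that by metis
qed

lemma stratified_isometric_image:
  fixes j :: "'a::metric_space \<Rightarrow> 'b::metric_space"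
  assumes "stratified S R" and iso: "\<And>x y. dist (j x) (j y) = dist x y"
  shows "stratified (j ` S) (j ` R)"
proof -
  have inj: "j x = j y \<longleftrightarrow> x = y" for x y
    using iso[of x y] by (metis dist_eq_0_iff)
  have contj: "continuous_on X j" for X
    unfolding continuous_on_iff using iso by metis
  define r where "r = inv j"
  have rj: "r (j x) = x" for x
    unfolding r_def using inj by (simp add: inj_def)
  have contr: "continuous_on (range j) r"
    unfolding continuous_on_iff using iso by (auto simp: rj)
  have img: "j ` r ` A = A" if "A \<subseteq> range j" for A
  proof -
    have "(\<lambda>y. j (r y)) ` A = (\<lambda>y. y) ` A"
      by (rule image_cong) (use that in \<open>auto simp: rj\<close>)
    then show ?thesis by (simp add: image_image)
  qed
  note S = stratifiedD[OF assms(1)]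
  have "j ` R \<subseteq> closure (j ` S)"
    using S(4) by (auto simp: closure_approachable iso subset_iff)
  moreover have "T \<subseteq> j ` S \<or> T \<subseteq> j ` R"
    if T: "T \<subseteq> j ` S \<union> j ` R" "path_connected T" for T
  proof -
    have "T \<subseteq> range j" using T by auto
    then have "path_connected (r ` T)"
      using T(2) contr continuous_on_subset path_connected_continuous_image by blast
    moreover have "r ` T \<subseteq> S \<union> R"
      using T(1) by (auto simp: rj)
    ultimately have "r ` T \<subseteq> S \<or> r ` T \<subseteq> R"
      using stratified_path_connected[OF assms(1)] by blast
    moreover have "T = j ` r ` T"
      using img[OF \<open>T \<subseteq> range j\<close>] by simp
    ultimately show ?thesis by blast
  qed
  moreover have "\<exists>e\<in>E. \<exists>d>0. ball e d \<inter> j ` R \<subseteq> E"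
    if E: "E \<subseteq> j ` R" "connected E" "a \<in> E" "b \<in> E" "a \<noteq> b" for E a b
  proof -
    have "E \<subseteq> range j" using E by auto
    then have "connected (r ` E)"
      using E(2) contr continuous_on_subset connected_continuous_image by blast
    moreover have "r ` E \<subseteq> R"
      using E(1) by (auto simp: rj)
    moreover have "r a \<noteq> r b"
      using E rj by (metis imageE subsetD)
    ultimately obtain e d where ed: "e \<in> r ` E" "d > 0" "ball e d \<inter> R \<subseteq> r ` E"
      using stratified_interior[OF assms(1), of "r ` E" "r a" "r b"] E by blast
    have E': "E = j ` r ` E"
      using img[OF \<open>E \<subseteq> range j\<close>] by simp
    have "ball (j e) d \<inter> j ` R \<subseteq> j ` (ball e d \<inter> R)"
      by (auto simp: iso)
    then have "ball (j e) d \<inter> j ` R \<subseteq> E"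
      using ed(3) E' by blast
    then show ?thesis
      using ed E' by blast
  qed
  moreover have "path_connected (j ` S)"
    using S(3) contj path_connected_continuous_image by blast
  ultimately show ?thesis
    unfolding stratified_def
  proof (intro conjI allI impI)
    show "j ` S \<inter> j ` R = {}"
      using S(1) inj by auto
    show "j ` R \<noteq> {}"
      using S(2) by simp
  qed (elim conjE; assumption | metis)+
qed

text \<open>
  The parameter \<open>u\<close> is turned into the first coordinate \<open>1 / u\<close>, which tends to \<open>0\<close>; the ray
  therefore runs towards the slice over \<open>0\<close>, where the remainder lies.
\<close>

definition ray :: "(real \<Rightarrow> complex) \<Rightarrow> (real \<times> complex) set" where
  "ray h = (\<lambda>u. (1 / u, h u)) ` {1..}"

definition remainder :: "complex set \<Rightarrow> (real \<times> complex) set" where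
  "remainder B = {0} \<times> B"

text \<open>
  The function \<open>h\<close> takes every value of \<open>B\<close> again and again, so that \<open>B\<close> is exactly its set of
  limit values at infinity. Since \<open>B\<close> has two points, \<open>h\<close> has no limit. The last assumption holds
  for arcs and circles, which inject continuously into the line once a point is removed.
\<close>

locale recurrent_ray =
  fixes h :: "real \<Rightarrow> complex" and B :: "complex set"
  assumes continuous_h: "continuous_on {1..} h"
    and h_in_B: "1 \<le> u \<Longrightarrow> h u \<in> B"
    and recurrent: "b \<in> B \<Longrightarrow> \<exists>u\<ge>M. h u = b"
    and compact_B: "compact B"
    and path_connected_B: "path_connected B"
    and two_points: "\<exists>b\<in>B. b \<noteq> c"
    and punctured_arc: "w \<in> B \<Longrightarrow>
      \<exists>\<phi>::complex \<Rightarrow> real. continuous_on (B - {w}) \<phi> \<and> inj_on \<phi> (B - {w})"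
begin

lemma fst_ray: "y \<in> ray h \<Longrightarrow> 0 < fst y \<and> fst y \<le> 1 \<and> snd y = h (1 / fst y)"
  by (auto simp: ray_def)

lemma ray_point: "u \<ge> 1 \<Longrightarrow> (1 / u, h u) \<in> ray h"
  by (auto simp: ray_def)

lemma continuous_on_ray_param: "continuous_on {1..} (\<lambda>u. (1 / u, h u))"
  using continuous_h by (intro continuous_intros) auto

lemma path_connected_ray: "path_connected (ray h)"
  unfolding ray_def
  by (intro path_connected_continuous_image continuous_on_ray_param)
    (simp add: convex_imp_path_connected)

text \<open>
  The union is an intersection of compact sets: beyond the parameter value \<open>m\<close> the ray is
  replaced by the full box \<open>[0, 1/m] \<times> B\<close>.
\<close>

lemma compact_ray_remainder: "compact (ray h \<union> remainder B)"
proof -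
  define K where "K m = {0..1 / real (Suc m)} \<times> B \<union> (\<lambda>u. (1 / u, h u)) ` {1..real (Suc m)}" for m
  have "compact (K m)" for m
    unfolding K_def
    by (intro compact_Un compact_Times compact_B compact_continuous_image compact_Icc
        continuous_on_subset[OF continuous_on_ray_param]) auto
  moreover have "ray h \<union> remainder B = (\<Inter>m. K m)"
  proof (intro equalityI subsetI INT_I)
    fix y m assume "y \<in> ray h \<union> remainder B"
    then show "y \<in> K m"
    proof
      assume "y \<in> ray h"
      then obtain u where u: "u \<ge> 1" "y = (1 / u, h u)"
        by (auto simp: ray_def)
      show ?thesis
      proof (cases "u \<le> real (Suc m)")
        case True
        then have "y \<in> (\<lambda>u. (1 / u, h u)) ` {1..real (Suc m)}"
          using u by simp
        then show ?thesis unfolding K_def by blast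
      next
        case False
        then have "1 / u \<le> 1 / real (Suc m)"
          by (intro divide_left_mono) auto
        then show ?thesis
          unfolding K_def using u h_in_B[OF u(1)] by simp
      qed
    qed (auto simp: K_def remainder_def)
  next
    fix y assume y: "y \<in> (\<Inter>m. K m)"
    then have yK: "y \<in> K m" for m
      by blast
    have y0: "fst y \<ge> 0"
      using yK[of 0] by (auto simp: K_def)
    show "y \<in> ray h \<union> remainder B"
    proof (cases "fst y = 0")
      case True
      have "y \<in> {0} \<times> B"
        using yK[of 0] True by (auto simp: K_def)
      then show ?thesis
        by (simp add: remainder_def)
    next
      case False
      then obtain m where m: "1 / real (Suc m) < fst y"
        using y0 nat_approx_posE[of "fst y"] by (metis less_eq_real_def)
      have "y \<in> (\<lambda>u. (1 / u, h u)) ` {1..real (Suc m)}"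
        using yK[of m] m unfolding K_def by auto
      then show ?thesis
        by (auto simp: ray_def)
    qed
  qed
  ultimately show ?thesis
    by (auto intro!: compact_Inter simp: image_iff)
qed

lemma remainder_subset_closure_ray: "remainder B \<subseteq> closure (ray h)"
proof
  fix y assume "y \<in> remainder B"
  then obtain b where b: "b \<in> B" "y = (0, b)"
    by (auto simp: remainder_def)
  have "\<exists>x\<in>ray h. dist x y < e" if "e > 0" for e
  proof -
    obtain u where u: "u \<ge> max 1 (2 / e)" "h u = b"
      using recurrent[OF b(1)] by blast
    then have u': "u \<ge> 1" "u \<ge> 2 / e" by simp_all
    have "u > 0" using u' by simp
    have "2 \<le> u * e"
      using u' that by (simp add: field_simps)
    then have "1 / u < e"
      using \<open>u > 0\<close> by (simp add: field_simps)
    moreover have "dist (1 / u, h u) y = 1 / u"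
      using u' u(2) b(2) by (simp add: dist_Pair_Pair)
    ultimately show ?thesis
      using ray_point[OF u'(1)] by force
  qed
  then show "y \<in> closure (ray h)"
    by (simp add: closure_approachable)
qed

text \<open>
  A path from the remainder to the ray has a last moment in the remainder. Right after it, the
  first coordinate takes all small positive values, so the second coordinate runs through all late
  values of \<open>h\<close>; as these recur to every point of \<open>B\<close>, the path cannot be continuous there.
\<close>

lemma path_stays_in_stratum:
  assumes "T \<subseteq> ray h \<union> remainder B" "path_connected T"
  shows "T \<subseteq> ray h \<or> T \<subseteq> remainder B"
proof (rule ccontr)
  assume "\<not> ?thesis"
  then obtain a b where ab: "a \<in> T" "a \<in> remainder B" "b \<in> T" "b \<in> ray h"
    using assms(1) by blast
  then obtain g where g: "path g" "path_image g \<subseteq> T" "pathstart g = a" "pathfinish g = b"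
    using assms(2) unfolding path_connected_def by blast
  have contg: "continuous_on {0..1} g"
    using g(1) by (simp add: path_def)
  have gT: "g s \<in> ray h \<union> remainder B" if "s \<in> {0..1}" for s
    using g(2) assms(1) that unfolding path_image_def by blast
  \<comment> \<open>the moments at which the path is in the remainder; the last one is \<open>s0\<close>\<close>
  define K where "K = {s \<in> {0..1}. fst (g s) = 0}"
  have "compact K"
  proof -
    have "closed {s \<in> {0..1}. fst (g s) = 0}"
      by (intro continuous_closed_preimage_constant continuous_on_fst contg) auto
    moreover have "bounded {s \<in> {0..1}. fst (g s) = 0}"
      by (rule bounded_subset[OF bounded_closed_interval[of 0 1]]) auto
    ultimately show ?thesis
      by (simp only: compact_eq_bounded_closed K_def)
  qed
  have "0 \<in> K"
    using ab(2) g(3) by (auto simp: K_def remainder_def pathstart_def)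
  then obtain s0 where s0: "s0 \<in> K" "\<And>s. s \<in> K \<Longrightarrow> s \<le> s0"
    using compact_attains_sup[OF \<open>compact K\<close>] by blast
  then have s01: "0 \<le> s0" "s0 \<le> 1" "fst (g s0) = 0"
    by (auto simp: K_def)
  have "fst (g 1) > 0"
    using ab(4) g(4) fst_ray by (auto simp: pathfinish_def)
  then have "s0 < 1"
    using s01 by (cases "s0 = 1") auto
  \<comment> \<open>a value of \<open>h\<close> away from \<open>g s0\<close>, which the path is forced to take next to \<open>s0\<close>\<close>
  obtain b' where b': "b' \<in> B" "b' \<noteq> snd (g s0)"
    using two_points by blast
  obtain \<delta> where \<delta>: "\<delta> > 0"
    "\<And>s. s \<in> {0..1} \<Longrightarrow> dist s s0 < \<delta> \<Longrightarrow> dist (g s) (g s0) < dist b' (snd (g s0))"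
    using contg s01 b'(2) unfolding continuous_on_iff
    by (metis atLeastAtMost_iff zero_less_dist_iff)
  define s1 where "s1 = min 1 (s0 + \<delta> / 2)"
  have s1: "s0 < s1" "s1 \<le> 1" "s1 - s0 < \<delta>"
    using \<open>s0 < 1\<close> \<delta>(1) by (auto simp: s1_def)
  have "s1 \<notin> K"
    using s0(2)[of s1] s1 by auto
  then have "fst (g s1) \<noteq> 0"
    using s1 s01 by (auto simp: K_def)
  then have "g s1 \<in> ray h"
    using gT[of s1] s1 s01 by (auto simp: remainder_def)
  then have pos: "fst (g s1) > 0"
    using fst_ray by blast
  obtain u where u: "u \<ge> max 1 (1 / fst (g s1))" "h u = b'"
    using recurrent[OF b'(1)] by blast
  then have "1 / u \<le> fst (g s1)" "u > 0"
    using pos by (auto simp: field_simps)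
  then obtain s where s: "s0 \<le> s" "s \<le> s1" "fst (g s) = 1 / u"
    using IVT'[of "\<lambda>s. fst (g s)" s0 "1 / u" s1] s1 s01
      continuous_on_subset[OF contg, of "{s0..s1}"]
    by (auto intro!: continuous_intros)
  then have "g s \<in> ray h"
    using gT[of s] s1 s01 \<open>u > 0\<close> by (auto simp: remainder_def)
  then have "snd (g s) = b'"
    using fst_ray[of "g s"] s(3) u(2) by simp
  moreover have "dist (g s) (g s0) < dist b' (snd (g s0))"
    using \<delta>(2)[of s] s s1 s01 by (auto simp: dist_real_def)
  ultimately show False
    using dist_snd_le[of "g s" "g s0"] by simp
qed

text \<open>
  If \<open>E\<close> misses a point \<open>w\<close> of \<open>B\<close>, the injection of \<open>B - {w}\<close> into the line maps \<open>E\<close> to a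
  nondegenerate interval, whose interior pulls back to a relatively open subset of \<open>B\<close>.
\<close>

lemma connected_subset_has_interior:
  assumes "E \<subseteq> B" "connected E" "a \<in> E" "b \<in> E" "a \<noteq> b"
  shows "\<exists>e\<in>E. \<exists>d>0. ball e d \<inter> B \<subseteq> E"
proof (cases "E = B")
  case True
  then show ?thesis using assms(3) zero_less_one by blast
next
  case False
  then obtain w where w: "w \<in> B" "w \<notin> E"
    using assms(1) by blast
  then obtain \<phi> :: "complex \<Rightarrow> real"
    where \<phi>: "continuous_on (B - {w}) \<phi>" "inj_on \<phi> (B - {w})"
    using punctured_arc by blast
  have EB: "E \<subseteq> B - {w}"
    using assms(1) w by blast
  have conn: "connected (\<phi> ` E)"
    using \<phi>(1) EB assms(2) connected_continuous_image continuous_on_subset by blast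
  have "\<exists>a\<in>E. \<exists>b\<in>E. \<phi> a < \<phi> b"
    using inj_onD[OF \<phi>(2), of a b] assms EB by (metis linorder_less_linear subsetD)
  then obtain a b where ab: "a \<in> E" "b \<in> E" "\<phi> a < \<phi> b"
    by blast
  have Icc: "{\<phi> a..\<phi> b} \<subseteq> \<phi> ` E"
    using conn ab connected_contains_Icc by blast
  have "(\<phi> a + \<phi> b) / 2 \<in> {\<phi> a..\<phi> b}"
    using ab by auto
  then obtain e where e: "e \<in> E" "\<phi> e = (\<phi> a + \<phi> b) / 2"
    using Icc by (metis imageE subsetD)
  obtain d where d: "d > 0" "\<And>y. y \<in> B - {w} \<Longrightarrow> dist y e < d \<Longrightarrow> dist (\<phi> y) (\<phi> e) < (\<phi> b - \<phi> a) / 2"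
  proof -
    have "e \<in> B - {w}" "(\<phi> b - \<phi> a) / 2 > 0"
      using EB e(1) ab(3) by auto
    with \<phi>(1) that show thesis
      unfolding continuous_on_iff by meson
  qed
  have "ball e (min d (dist e w)) \<inter> B \<subseteq> E"
  proof
    fix y assume y: "y \<in> ball e (min d (dist e w)) \<inter> B"
    then have yB: "y \<in> B - {w}" by auto
    then have "\<bar>\<phi> y - \<phi> e\<bar> < (\<phi> b - \<phi> a) / 2"
      using d(2)[of y] y by (simp add: dist_commute[of y] dist_real_def)
    then have "\<phi> y \<in> {\<phi> a..\<phi> b}"
      unfolding e(2) by (auto simp: abs_less_iff field_simps)
    then obtain y' where "y' \<in> E" "\<phi> y' = \<phi> y"
      using Icc by (metis imageE subsetD)
    then show "y \<in> E"
      using \<phi>(2) yB EB by (metis inj_onD subsetD)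
  qed
  moreover have "min d (dist e w) > 0"
    using d(1) e(1) w(2) by auto
  ultimately show ?thesis
    using e(1) by blast
qed

lemma stratified_ray_remainder: "stratified (ray h) (remainder B)"
proof -
  have int: "\<exists>e\<in>E. \<exists>d>0. ball e d \<inter> remainder B \<subseteq> E"
    if E: "E \<subseteq> remainder B" "connected E" "a \<in> E" "b \<in> E" "a \<noteq> b" for E a b
  proof -
    have "connected (snd ` E)"
      using E(2) by (intro connected_continuous_image continuous_intros)
    moreover have "snd ` E \<subseteq> B"
      using E(1) by (auto simp: remainder_def)
    moreover have "snd a \<in> snd ` E" "snd b \<in> snd ` E"
      using E(3,4) by blast+
    moreover have "snd a \<noteq> snd b"
    proof -
      have "fst a = 0" "fst b = 0"
        using E(1,3,4) by (auto simp: remainder_def)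
      then show ?thesis
        using E(5) by (simp add: prod_eq_iff)
    qed
    ultimately obtain e d where ed: "e \<in> snd ` E" "d > 0" "ball e d \<inter> B \<subseteq> snd ` E"
      using connected_subset_has_interior[of "snd ` E" "snd a" "snd b"] by blast
    have E0: "fst y = 0" if "y \<in> E" for y
      using E(1) that by (auto simp: remainder_def)
    have E': "y \<in> E \<longleftrightarrow> fst y = 0 \<and> snd y \<in> snd ` E" for y
      by (auto simp: E0) (metis E0 prod.collapse snd_conv)
    have "ball (0, e) d \<inter> remainder B \<subseteq> E"
    proof
      fix y assume "y \<in> ball (0, e) d \<inter> remainder B"
      then have "fst y = 0" "snd y \<in> ball e d \<inter> B"
        using dist_snd_le[of "(0, e)" y] by (auto simp: remainder_def)
      then show "y \<in> E"
        using ed(3) E' by blast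
    qed
    then show ?thesis
      using ed(1,2) E'[of "(0, e)"] by auto
  qed
  have "remainder B \<noteq> {}"
    using two_points by (auto simp: remainder_def)
  moreover have "ray h \<inter> remainder B = {}"
    by (auto simp: ray_def remainder_def)
  ultimately show ?thesis
    unfolding stratified_def
    using path_connected_ray remainder_subset_closure_ray path_stays_in_stratum int
    by (intro conjI allI impI; (elim conjE)?; metis)
qed

end

section \<open>Closed sets with an accessible point\<close>

lemma is_alpha_limit_setI:
  fixes Z :: "'a::metric_space set"
  assumes "continuous_on Z f" "f ` Z \<subseteq> Z" "x \<in> Z"
    and "\<And>y. y \<in> alpha_limit (top_of_set Z) f x \<longleftrightarrow> y \<in> A"
  shows "is_alpha_limit_set (top_of_set Z) A"
proof -
  have "A = alpha_limit (top_of_set Z) f x"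
    using assms(4) by blast
  moreover have "continuous_map (top_of_set Z) (top_of_set Z) f"
    using assms(1,2) by (simp add: image_subset_iff_funcset)
  ultimately show ?thesis
    unfolding is_alpha_limit_set_def using assms(3) topspace_euclidean_subtopology by blast
qed

text \<open>
  The simplest way to realise \<open>A\<close>: the map collapses \<open>A\<close> to a point \<open>x\<close> of \<open>A\<close>, and nothing outside
  \<open>A\<close> ever enters \<open>A\<close>. Then every iterated preimage of \<open>x\<close> is \<open>A\<close> itself.
\<close>

lemma is_alpha_limit_set_trap:
  fixes Z :: "'a::metric_space set"
  assumes "continuous_on Z f" "f ` Z \<subseteq> Z" "closedin (top_of_set Z) A" "x \<in> A"
    and fx: "\<And>y. y \<in> Z \<Longrightarrow> f y = x \<longleftrightarrow> y \<in> A"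
    and fA: "\<And>y. y \<in> Z \<Longrightarrow> f y \<in> A \<Longrightarrow> y \<in> A"
  shows "is_alpha_limit_set (top_of_set Z) A"
proof -
  have AZ: "A \<subseteq> Z"
    using assms(3) closedin_imp_subset by blast
  have it: "(f ^^ Suc k) y = x \<longleftrightarrow> y \<in> A" if "y \<in> Z" for k y
    using that
  proof (induction k arbitrary: y)
    case 0
    then show ?case using fx by simp
  next
    case (Suc k)
    have "(f ^^ Suc (Suc k)) y = (f ^^ Suc k) (f y)"
      by (simp only: funpow_Suc_right o_apply)
    also have "\<dots> = x \<longleftrightarrow> f y \<in> A"
      using Suc assms(2) by blast
    also have "\<dots> \<longleftrightarrow> y \<in> A"
      using fx[OF Suc.prems] fA[OF Suc.prems] assms(4) by auto
    finally show ?case .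
  qed
  show ?thesis
  proof (rule is_alpha_limit_setI[OF assms(1,2)])
    show "x \<in> Z"
      using assms(4) AZ by blast
    fix y
    show "y \<in> alpha_limit (top_of_set Z) f x \<longleftrightarrow> y \<in> A"
    proof
      assume y: "y \<in> alpha_limit (top_of_set Z) f x"
      have "\<exists>z\<in>A. dist z y < e" if e: "e > 0" for e
      proof -
        obtain k z where k: "k \<ge> 1" "z \<in> Z" "(f ^^ k) z = x" "dist z y < e"
          using y e unfolding mem_alpha_limit_top_of_set by meson
        then obtain k' where "k = Suc k'"
          by (cases k) auto
        then show ?thesis using it[OF k(2)] k by blast
      qed
      then have "y \<in> closure A"
        by (simp add: closure_approachable)
      moreover have "y \<in> Z"
        using y by (simp add: mem_alpha_limit_top_of_set)
      ultimately show "y \<in> A"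
        using assms(3) closedin_top_of_set_closure by blast
    next
      assume y: "y \<in> A"
      show "y \<in> alpha_limit (top_of_set Z) f x"
        unfolding mem_alpha_limit_top_of_set
      proof (intro conjI allI impI)
        fix n :: nat and e :: real assume "e > 0"
        then show "\<exists>k\<ge>n. \<exists>z\<in>Z. (f ^^ k) z = x \<and> dist z y < e"
          using y AZ it[of y n] by (intro exI[of _ "Suc n"]) (auto intro!: bexI[of _ y])
      qed (use y AZ in auto)
    qed
  qed
qed

text \<open>
  A constant map omits a point, which then has no preimages under positive iterates.
\<close>

lemma is_alpha_limit_set_empty:
  fixes Z :: "'a::metric_space set"
  assumes "a \<in> Z" "b \<in> Z" "a \<noteq> b"
  shows "is_alpha_limit_set (top_of_set Z) {}"
proof -
  have "((\<lambda>_. a) ^^ k) z \<noteq> b" if "k \<ge> 1" for k and z :: 'a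
  proof -
    have "((\<lambda>_. a) ^^ Suc k') z = a" for k'
      by simp
    then show ?thesis
      using that assms(3) by (metis Suc_le_D One_nat_def)
  qed
  then have "y \<notin> alpha_limit (top_of_set Z) (\<lambda>_. a) b" for y
    unfolding mem_alpha_limit_top_of_set by (metis zero_less_one)
  then show ?thesis
    using assms by (intro is_alpha_limit_setI[of _ "\<lambda>_. a" b]) auto
qed

lemma is_alpha_limit_set_clopen:
  fixes Z :: "'a::metric_space set"
  assumes "closedin (top_of_set Z) A" "openin (top_of_set Z) A" "A \<noteq> {}"
  shows "is_alpha_limit_set (top_of_set Z) A"
proof -
  obtain x where x: "x \<in> A"
    using assms(3) by blast
  have AZ: "A \<subseteq> Z"
    using assms(1) closedin_imp_subset by blast
  have "closedin (top_of_set Z) (Z - A)"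
    using assms(2) by (simp add: closedin_diff)
  then have "continuous_on (A \<union> (Z - A)) (\<lambda>y. if y \<in> A then x else y)"
    using assms(1) AZ
    by (intro continuous_on_cases_local) (auto simp: Un_absorb1)
  moreover have "A \<union> (Z - A) = Z"
    using AZ by blast
  ultimately show ?thesis
    using x AZ assms(1)
    by (intro is_alpha_limit_set_trap[where x = x and f = "\<lambda>y. if y \<in> A then x else y"])
      (auto split: if_splits)
qed

text \<open>
  If an arc \<open>g\<close> starts in \<open>A\<close> and leaves it at once, send each point \<open>y\<close> to the point of the arc whose
  parameter is the distance from \<open>y\<close> to \<open>A\<close>. This map traps exactly \<open>A\<close>.
\<close>

lemma is_alpha_limit_set_accessible:
  fixes Z :: "'a::metric_space set" and g :: "real \<Rightarrow> 'a"
  assumes A: "closedin (top_of_set Z) A"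
    and g: "continuous_on {0..1} g" "g ` {0..1} \<subseteq> Z" "g 0 \<in> A" "\<And>s. 0 < s \<Longrightarrow> s \<le> 1 \<Longrightarrow> g s \<notin> A"
  shows "is_alpha_limit_set (top_of_set Z) A"
proof -
  define f where "f = (\<lambda>y. g (min 1 (infdist y A)))"
  have "A \<noteq> {}" using g(3) by blast
  have dist0: "infdist y A = 0 \<longleftrightarrow> y \<in> A" if "y \<in> Z" for y
  proof -
    have "y \<in> closure A \<longleftrightarrow> y \<in> A"
      using closure_subset closedin_top_of_set_closure[OF A that] by blast
    then show ?thesis
      using in_closure_iff_infdist_zero[OF \<open>A \<noteq> {}\<close>] by simp
  qed
  have range: "min 1 (infdist y A) \<in> {0..1}" for y
    by (simp add: infdist_nonneg)
  have fA: "f y \<in> A \<longleftrightarrow> y \<in> A" "y \<in> A \<Longrightarrow> f y = g 0" if "y \<in> Z" for y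
  proof -
    show "y \<in> A \<Longrightarrow> f y = g 0"
      using dist0[OF that] by (simp add: f_def)
    moreover have "f y \<notin> A" if "y \<notin> A"
    proof -
      have "infdist y A > 0"
        using dist0[OF \<open>y \<in> Z\<close>] that infdist_nonneg[of y A] by linarith
      then show ?thesis
        unfolding f_def by (intro g(4)) auto
    qed
    ultimately show "f y \<in> A \<longleftrightarrow> y \<in> A"
      using g(3) by auto
  qed
  have "continuous_on Z f"
    unfolding f_def
    by (rule continuous_on_compose2[OF g(1)])
      (use range in \<open>auto intro!: continuous_intros\<close>)
  moreover have "f ` Z \<subseteq> Z"
    using g(2) range unfolding f_def by blast
  ultimately show ?thesis
    using fA g(3) A by (intro is_alpha_limit_set_trap[where x = "g 0" and f = f]) metis+
qed

text \<open>
  A path from \<open>A\<close> to its complement yields an arc as above, by starting at its last moment in \<open>A\<close>.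
\<close>

lemma is_alpha_limit_set_splits_path_connected:
  fixes Z :: "'a::metric_space set"
  assumes A: "closedin (top_of_set Z) A"
    and C: "path_connected C" "C \<subseteq> Z" "a \<in> C" "a \<in> A" "c \<in> C" "c \<notin> A"
  shows "is_alpha_limit_set (top_of_set Z) A"
proof -
  obtain g where g: "path g" "path_image g \<subseteq> C" "pathstart g = a" "pathfinish g = c"
    using C unfolding path_connected_def by blast
  have contg: "continuous_on {0..1} g" and gZ: "g ` {0..1} \<subseteq> Z" and g01: "g 0 = a" "g 1 = c"
    using g C(2) by (auto simp: path_def path_image_def pathstart_def pathfinish_def)
  define K where "K = {0..1} \<inter> g -` A"
  have "closedin (top_of_set {0..1}) K"
    unfolding K_def using continuous_closedin_preimage_gen[OF contg _ A] gZ by blast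
  then have "compact K"
    using closedin_compact compact_Icc by blast
  moreover have "0 \<in> K"
    using C g01 by (simp add: K_def)
  ultimately obtain s0 where s0: "s0 \<in> K" "\<And>s. s \<in> K \<Longrightarrow> s \<le> s0"
    using compact_attains_sup[of K] by blast
  have s0': "0 \<le> s0" "s0 \<le> 1" "g s0 \<in> A"
    using s0(1) by (auto simp: K_def)
  have "s0 \<noteq> 1"
    using s0' g01 C by auto
  then have "s0 < 1" using s0' by simp
  have range: "s0 + (1 - s0) * s \<in> {0..1}" if "s \<in> {0..1}" for s
  proof -
    have "(1 - s0) * s \<le> (1 - s0) * 1"
      using that s0' by (intro mult_left_mono) auto
    then show ?thesis using that s0' by simp
  qed
  show ?thesis
  proof (rule is_alpha_limit_set_accessible[OF A])
    show "continuous_on {0..1} (\<lambda>s. g (s0 + (1 - s0) * s))"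
      by (rule continuous_on_compose2[OF contg]) (use range in \<open>auto intro!: continuous_intros\<close>)
    show "(\<lambda>s. g (s0 + (1 - s0) * s)) ` {0..1} \<subseteq> Z"
      using range gZ by blast
    show "g (s0 + (1 - s0) * 0) \<in> A"
      using s0' by simp
    fix s :: real assume s: "0 < s" "s \<le> 1"
    have "s0 + (1 - s0) * s > s0"
      using s \<open>s0 < 1\<close> by simp
    then have "s0 + (1 - s0) * s \<notin> K"
      using s0(2) by force
    then show "g (s0 + (1 - s0) * s) \<notin> A"
      using range[of s] s by (auto simp: K_def)
  qed
qed

section \<open>Compactified rays with the AF-property\<close>

text \<open>
  The point \<open>(2, 0)\<close> only serves as an isolated point: in a product of two such spaces it
  provides clopen copies of both ray compactifications.
\<close>

definition pointed_space :: "(real \<Rightarrow> complex) \<Rightarrow> complex set \<Rightarrow> (real \<times> complex) set" where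
  "pointed_space h B = insert (2, 0) (ray h \<union> remainder B)"

context recurrent_ray
begin

lemma isolated_point_notin: "(2, 0) \<notin> ray h \<union> remainder B"
  using fst_ray[of "(2, 0)"] by (auto simp: remainder_def)

lemma compact_pointed_space: "compact (pointed_space h B)"
  unfolding pointed_space_def by (intro compact_insert compact_ray_remainder)

lemma clopen_ray_remainder:
  "closedin (top_of_set (pointed_space h B)) (ray h \<union> remainder B)"
  "openin (top_of_set (pointed_space h B)) (ray h \<union> remainder B)"
proof -
  show "closedin (top_of_set (pointed_space h B)) (ray h \<union> remainder B)"
    using compact_ray_remainder
    by (intro closed_subset compact_imp_closed) (auto simp: pointed_space_def)
  have "closedin (top_of_set (pointed_space h B)) {(2, 0)}"
    by (intro closed_subset) (auto simp: pointed_space_def)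
  moreover have "ray h \<union> remainder B = pointed_space h B - {(2, 0)}"
    using isolated_point_notin by (auto simp: pointed_space_def)
  ultimately show "openin (top_of_set (pointed_space h B)) (ray h \<union> remainder B)"
    using openin_diff[OF openin_subtopology_self] by metis
qed

lemma clopen_isolated_point:
  "openin (top_of_set (pointed_space h B)) {(2, 0)}"
  "closedin (top_of_set (pointed_space h B)) {(2, 0)}"
proof -
  have eq: "pointed_space h B - (ray h \<union> remainder B) = {(2, 0)}"
    using isolated_point_notin by (auto simp: pointed_space_def)
  show "openin (top_of_set (pointed_space h B)) {(2, 0)}"
    using openin_diff[OF openin_subtopology_self clopen_ray_remainder(1)] unfolding eq .
  show "closedin (top_of_set (pointed_space h B)) {(2, 0)}"
    by (intro closed_subset) (auto simp: pointed_space_def)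
qed

end

text \<open>
  The self-map \<open>(t, z) \<mapsto> (t / 2, G z)\<close> doubles the parameter of the ray. On the remainder it is \<open>G\<close>,
  whose fixed point \<open>b0\<close> has a dense backward orbit.
\<close>

locale expanding_ray = recurrent_ray +
  fixes G :: "complex \<Rightarrow> complex" and b0 :: complex
  assumes continuous_G: "continuous_on B G"
    and G_in_B: "b \<in> B \<Longrightarrow> G b \<in> B"
    and doubling: "1 \<le> u \<Longrightarrow> h (2 * u) = G (h u)"
    and b0: "b0 \<in> B" "G b0 = b0"
    and dense_preimages: "b \<in> B \<Longrightarrow> 0 < e \<Longrightarrow> \<exists>k. \<exists>d\<in>B. (G ^^ k) d = b0 \<and> dist d b < e"
begin

text \<open>
  This is the case that no arc can handle. The doubling map preserves the ray, so all preimages of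
  \<open>(0, b0)\<close> in the ray compactification lie in the remainder, where they accumulate everywhere. The
  isolated point is sent to \<open>(0, b0)\<close> or fixed, according to whether it shall belong to the limit set.
\<close>

lemma is_alpha_limit_set_remainder:
  assumes "P \<subseteq> {(2, 0)}"
  shows "is_alpha_limit_set (top_of_set (pointed_space h B)) (P \<union> remainder B)"
proof -
  define W where "W = ray h \<union> remainder B"
  define p :: "real \<times> complex" where "p = (2, 0)"
  define x :: "real \<times> complex" where "x = (0, b0)"
  define f where "f y = (if y \<in> W then (fst y / 2, G (snd y)) else if p \<in> P then x else p)" for y
  have Z: "pointed_space h B = insert p W" and pW: "p \<notin> W"
    using isolated_point_notin by (auto simp: pointed_space_def W_def p_def)
  have xR: "x \<in> remainder B"
    using b0 by (auto simp: x_def remainder_def)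
  have f_ray: "f y \<in> ray h" if y: "y \<in> ray h" for y
  proof -
    obtain u where u: "u \<ge> 1" "y = (1 / u, h u)"
      using y by (auto simp: ray_def)
    then have "f y = (1 / (2 * u), h (2 * u))"
      using y doubling[OF u(1)] by (simp add: f_def W_def)
    then show ?thesis
      using ray_point[of "2 * u"] u by simp
  qed
  have f_rem: "f (0, b) = (0, G b)" "f (0, b) \<in> remainder B" if b: "b \<in> B" for b
    using b G_in_B by (auto simp: f_def W_def remainder_def)
  have fp: "f p = (if p \<in> P then x else p)"
    using pW by (simp add: f_def)
  have "snd ` W \<subseteq> B"
    using h_in_B by (auto simp: W_def ray_def remainder_def)
  then have "continuous_on W (\<lambda>y. (fst y / 2, G (snd y)))"
    by (intro continuous_intros continuous_on_compose2[OF continuous_G]) auto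
  then have "continuous_on (W \<union> {p}) f"
    unfolding f_def using pW compact_ray_remainder
    by (intro continuous_on_cases) (auto simp: W_def compact_imp_closed)
  then have contf: "continuous_on (insert p W) f"
    by simp
  have fW: "f y \<in> W" if "y \<in> W" for y
    using f_ray f_rem(2) that unfolding W_def remainder_def by blast
  have fZ: "f ` insert p W \<subseteq> insert p W"
  proof -
    have "f p \<in> insert p W"
      using fp xR by (auto simp: W_def)
    then show ?thesis
      using fW by blast
  qed
  have it_ray: "(f ^^ k) y \<in> ray h" if "y \<in> ray h" for k y
    using that f_ray by (induction k) auto
  have it_rem: "(f ^^ k) (0, d) = (0, (G ^^ k) d) \<and> (G ^^ k) d \<in> B" if "d \<in> B" for k d
    using that f_rem G_in_B by (induction k) auto
  have it_x: "(f ^^ k) x = x" for k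
    using f_rem(1)[OF b0(1)] b0(2) by (induction k) (auto simp: x_def)
  have it_p: "(f ^^ k) p = x \<longleftrightarrow> p \<in> P" if k: "k \<ge> 1" for k
  proof (cases "p \<in> P")
    case True
    then have "f p = x"
      using fp by simp
    moreover obtain k' where "k = Suc k'"
      using k by (cases k) auto
    ultimately have "(f ^^ k) p = x"
      using it_x[of k'] by (simp only: funpow_Suc_right o_apply)
    then show ?thesis
      using True by simp
  next
    case False
    then have "(f ^^ k) p = p"
      using fp by (induction k) auto
    then show ?thesis
      using False xR pW by (auto simp: W_def)
  qed
  have xray: "x \<notin> ray h"
    using fst_ray[of x] by (auto simp: x_def)
  show ?thesis
    unfolding Z
  proof (rule is_alpha_limit_setI[OF contf fZ])
    show "x \<in> insert p W"
      using xR by (simp add: W_def)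
    fix y
    show "y \<in> alpha_limit (top_of_set (insert p W)) f x \<longleftrightarrow> y \<in> P \<union> remainder B"
    proof
      assume y: "y \<in> alpha_limit (top_of_set (insert p W)) f x"
      have "y \<in> closure (P \<union> remainder B)"
        unfolding closure_approachable
      proof (intro allI impI)
        fix e :: real assume "e > 0"
        then obtain k z where k: "k \<ge> 1" "z \<in> insert p W" "(f ^^ k) z = x" "dist z y < e"
          using y unfolding mem_alpha_limit_top_of_set by meson
        have "z \<notin> ray h"
          using it_ray[of z k] k(3) xray by auto
        then have "z \<in> P \<union> remainder B"
          using k it_p[of k] by (auto simp: W_def)
        then show "\<exists>z\<in>P \<union> remainder B. dist z y < e"
          using k(4) by blast
      qed
      moreover have "closed (P \<union> remainder B)"
        unfolding remainder_def using finite_subset[OF assms]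
        by (intro closed_Un closed_Times compact_imp_closed[OF compact_B] finite_imp_closed) auto
      ultimately show "y \<in> P \<union> remainder B"
        by (simp only: closure_closed)
    next
      assume y: "y \<in> P \<union> remainder B"
      show "y \<in> alpha_limit (top_of_set (insert p W)) f x"
        unfolding mem_alpha_limit_top_of_set
      proof (intro conjI allI impI)
        show "y \<in> insert p W"
          using y assms by (auto simp: W_def p_def)
        fix n :: nat and e :: real assume e: "e > 0"
        show "\<exists>k\<ge>n. \<exists>z\<in>insert p W. (f ^^ k) z = x \<and> dist z y < e"
        proof (cases "y \<in> P")
          case True
          then have "y = p" using assms by (auto simp: p_def)
          then show ?thesis
            using it_p[of "Suc n"] True e by (intro exI[of _ "Suc n"]) auto
        next
          case False
          then obtain b where b: "b \<in> B" "y = (0, b)"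
            using y by (auto simp: remainder_def)
          obtain k d where kd: "d \<in> B" "(G ^^ k) d = b0" "dist d b < e"
            using dense_preimages[OF b(1) e] by blast
          have "(f ^^ (n + k)) (0, d) = x"
            using it_rem[OF kd(1), of k] kd(2) it_x[of n] by (simp add: funpow_add x_def)
          moreover have "dist (0, d) y < e"
            using kd(3) b(2) by (simp add: dist_Pair_Pair)
          moreover have "(0, d) \<in> insert p W"
            using kd(1) by (auto simp: W_def remainder_def)
          ultimately show ?thesis
            by (intro exI[of _ "n + k"]) auto
        qed
      qed
    qed
  qed
qed

text \<open>
  A closed set that contains a part, but not all, of the ray or of the remainder has an accessible
  point. As the remainder lies in the closure of the ray, all other closed sets are clopen
  or consist of the remainder and possibly the isolated point.
\<close>

theorem AF_property_pointed_space: "AF_property (top_of_set (pointed_space h B))"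
  unfolding AF_property_iff
proof (intro allI impI)
  let ?Z = "pointed_space h B"
  fix A assume A: "closedin (top_of_set ?Z) A"
  have AZ: "A \<subseteq> ?Z"
    using A closedin_imp_subset by blast
  have subs: "ray h \<subseteq> ?Z" "remainder B \<subseteq> ?Z" "(2, 0) \<in> ?Z"
    by (auto simp: pointed_space_def)
  have pcR: "path_connected (remainder B)"
    unfolding remainder_def by (intro path_connected_Times path_connected_B) simp
  obtain r where r: "r \<in> remainder B"
    using b0 by (auto simp: remainder_def)
  show "is_alpha_limit_set (top_of_set ?Z) A"
  proof (cases "(\<exists>a\<in>ray h. a \<in> A) \<and> (\<exists>c\<in>ray h. c \<notin> A) \<or>
      (\<exists>a\<in>remainder B. a \<in> A) \<and> (\<exists>c\<in>remainder B. c \<notin> A)")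
    case True
    then show ?thesis
      using is_alpha_limit_set_splits_path_connected[OF A] path_connected_ray pcR subs by blast
  next
    case False
    then have S: "ray h \<subseteq> A \<or> ray h \<inter> A = {}" and R: "remainder B \<subseteq> A \<or> remainder B \<inter> A = {}"
      by blast+
    have SR: "remainder B \<subseteq> A" if "ray h \<subseteq> A"
    proof -
      have "compact A"
        using A compact_pointed_space closedin_compact by blast
      then have "closure (ray h) \<subseteq> A"
        using that by (simp add: closure_minimal compact_imp_closed)
      then show ?thesis
        using remainder_subset_closure_ray by blast
    qed
    define P where "P = A \<inter> {(2, 0)}"
    have "A = P \<or> A = P \<union> remainder B \<or> A = P \<union> (ray h \<union> remainder B)"
      using S R SR AZ unfolding P_def pointed_space_def by blast
    moreover have "P = {} \<or> P = {(2, 0)}"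
      by (auto simp: P_def)
    ultimately have "A = {} \<or> A = P \<union> remainder B \<or> openin (top_of_set ?Z) A"
      using clopen_ray_remainder(2) clopen_isolated_point(1) by (metis openin_Un Un_empty_left)
    then consider "A = {}" | "A = P \<union> remainder B" | "A \<noteq> {}" "openin (top_of_set ?Z) A"
      by blast
    then show ?thesis
    proof cases
      case 1
      then show ?thesis
        using is_alpha_limit_set_empty[of "(2, 0)" ?Z r] subs r isolated_point_notin by auto
    next
      case 2
      then show ?thesis
        using is_alpha_limit_set_remainder[of P] by (simp add: P_def)
    next
      case 3
      then show ?thesis
        using is_alpha_limit_set_clopen[OF A] by blast
    qed
  qed
qed

end

section \<open>The obstruction in a product\<close>

lemma alpha_limit_forward_invariant:
  fixes Z :: "'a::metric_space set"
  assumes "continuous_on Z f" "f ` Z \<subseteq> Z" "y \<in> alpha_limit (top_of_set Z) f x"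
  shows "f y \<in> alpha_limit (top_of_set Z) f x"
  unfolding mem_alpha_limit_top_of_set
proof (intro conjI allI impI)
  have y: "y \<in> Z"
    using assms(3) by (simp add: mem_alpha_limit_top_of_set)
  then show "f y \<in> Z"
    using assms(2) by blast
  fix n :: nat and e :: real assume "e > 0"
  then obtain d where d: "d > 0" "\<And>z. z \<in> Z \<Longrightarrow> dist z y < d \<Longrightarrow> dist (f z) (f y) < e"
    using assms(1) y unfolding continuous_on_iff by meson
  obtain k z where k: "k \<ge> Suc n" "z \<in> Z" "(f ^^ k) z = x" "dist z y < d"
    using assms(3) d(1) unfolding mem_alpha_limit_top_of_set by meson
  obtain k' where k': "k = Suc k'"
    using k(1) by (cases k) auto
  have "(f ^^ k') (f z) = x"
    using k(3) unfolding k' by (simp only: funpow_Suc_right o_apply)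
  then show "\<exists>k\<ge>n. \<exists>z\<in>Z. (f ^^ k) z = x \<and> dist z (f y) < e"
    using d(2)[OF k(2,4)] k(1,2) k' assms(2) by (intro exI[of _ k']) auto
qed

text \<open>
  Otherwise late preimages in \<open>D\<close> would accumulate at a point of \<open>D\<close>, which would lie in the limit set.
\<close>

lemma compact_avoids_late_preimages:
  fixes Z :: "'a::metric_space set"
  assumes "compact D" "D \<subseteq> Z" "D \<inter> alpha_limit (top_of_set Z) f x = {}"
  obtains n where "\<And>k z. k \<ge> n \<Longrightarrow> z \<in> D \<Longrightarrow> (f ^^ k) z \<noteq> x"
proof -
  have "\<exists>n. \<forall>k\<ge>n. \<forall>z\<in>D. (f ^^ k) z \<noteq> x"
  proof (rule ccontr)
    assume "\<not> ?thesis"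
    then obtain \<kappa> \<zeta> where \<kappa>: "\<And>n. \<kappa> n \<ge> n" "\<And>n. \<zeta> n \<in> D" "\<And>n. (f ^^ \<kappa> n) (\<zeta> n) = x"
      by metis
    obtain y \<rho> where y: "y \<in> D" "strict_mono \<rho>" "(\<zeta> \<circ> \<rho>) \<longlonglongrightarrow> y"
      using assms(1) \<kappa>(2) unfolding compact_def by metis
    have "y \<in> alpha_limit (top_of_set Z) f x"
      unfolding mem_alpha_limit_top_of_set
    proof (intro conjI allI impI)
      show "y \<in> Z" using y assms(2) by blast
      fix n :: nat and e :: real assume "e > 0"
      then obtain N where N: "\<And>m. m \<ge> N \<Longrightarrow> dist (\<zeta> (\<rho> m)) y < e"
        using y(3) unfolding lim_sequentially by auto
      define m where "m = max N n"
      have "\<kappa> (\<rho> m) \<ge> n"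
        using \<kappa>(1)[of "\<rho> m"] seq_suble[OF y(2), of m] by (simp add: m_def)
      moreover have "dist (\<zeta> (\<rho> m)) y < e"
        by (rule N) (simp add: m_def)
      ultimately show "\<exists>k\<ge>n. \<exists>z\<in>Z. (f ^^ k) z = x \<and> dist z y < e"
        using \<kappa>(2,3)[of "\<rho> m"] assms(2) by blast
    qed
    then show False
      using y(1) assms(3) by blast
  qed
  then show ?thesis using that by blast
qed

lemma connected_subset_clopen:
  assumes "connected T" "T \<subseteq> Z" "openin (top_of_set Z) C" "closedin (top_of_set Z) C" "T \<inter> C \<noteq> {}"
  shows "T \<subseteq> C"
proof -
  obtain U V where U: "open U" "C = Z \<inter> U" and V: "closed V" "C = Z \<inter> V"
    using assms(3,4) unfolding openin_open closedin_closed by blast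
  have TU: "T \<inter> C = T \<inter> U" and TV: "T \<inter> C = T \<inter> V"
    using U(2) V(2) assms(2) by blast+
  have "openin (top_of_set T) (T \<inter> C)"
    unfolding TU using U(1) by (rule openin_open_Int)
  moreover have "closedin (top_of_set T) (T \<inter> C)"
    unfolding TV using V(1) by (rule closedin_closed_Int)
  ultimately have "T \<inter> C = {} \<or> T \<inter> C = T"
    using assms(1) unfolding connected_clopen by blast
  then show ?thesis
    using assms(5) by blast
qed

lemma stratified_connected:
  assumes "stratified S R"
  shows "connected (S \<union> R)"
proof (rule connected_intermediate_closure[of S])
  show "connected S"
    using stratifiedD(3)[OF assms] by (rule path_connected_imp_connected)
  show "S \<union> R \<subseteq> closure S"
    using stratifiedD(4)[OF assms] closure_subset by blast
qed blast

lemma openin_top_of_setD: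
  fixes Z :: "'a::metric_space set"
  assumes "openin (top_of_set Z) C" "y \<in> C"
  obtains d where "d > 0" "\<And>z. z \<in> Z \<Longrightarrow> dist z y < d \<Longrightarrow> z \<in> C"
  using assms unfolding openin_euclidean_subtopology_iff by metis

text \<open>
  The limit set is forward invariant, so the image of \<open>C\<close> meets one of the two clopen sets.
\<close>

lemma image_in_one_component:
  fixes Z :: "'a::metric_space set"
  assumes f: "continuous_on Z f" "f ` Z \<subseteq> Z"
    and C1: "openin (top_of_set Z) C1" "closedin (top_of_set Z) C1"
    and C2: "openin (top_of_set Z) C2" "closedin (top_of_set Z) C2"
    and alpha: "alpha_limit (top_of_set Z) f x \<subseteq> C1 \<union> C2"
    and C: "connected C" "C \<subseteq> Z" "r \<in> C" "r \<in> alpha_limit (top_of_set Z) f x"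
  shows "f ` C \<subseteq> C1 \<or> f ` C \<subseteq> C2"
proof -
  have fC: "connected (f ` C)" "f ` C \<subseteq> Z"
    using C f continuous_on_subset connected_continuous_image by blast+
  have "f r \<in> C1 \<union> C2"
    using alpha_limit_forward_invariant[OF f C(4)] alpha by blast
  then have "f ` C \<inter> C1 \<noteq> {} \<or> f ` C \<inter> C2 \<noteq> {}"
    using C(3) by blast
  then show ?thesis
    using connected_subset_clopen[OF fC C1] connected_subset_clopen[OF fC C2] by blast
qed

text \<open>
  Suppose that \<open>R1 \<union> R2\<close> is the limit set of a point \<open>x\<close> in the first component. Preimages of \<open>x\<close>
  are found near \<open>R2\<close>, so the second component is mapped into the first one, and even into \<open>R1\<close>,
  because its ray is not mapped into the ray \<open>S1\<close>. Hence for an arc \<open>D\<close> in \<open>S2\<close> the set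
  \<open>f (f D)\<close> lies in one of the remainders. Late preimages of \<open>x\<close> avoid \<open>D\<close>, hence also \<open>f (f D)\<close>; but
  within the remainders they accumulate at every point of \<open>f R1\<close>. So \<open>f (f D)\<close> has no interior in the
  remainder and must be a point. Thus \<open>f \<circ> f\<close> is constant on the second component, and each late
  preimage of \<open>x\<close> contains all of it or none of it, although only \<open>R2\<close> belongs to the limit set.
\<close>

lemma alpha_limit_not_both_remainders_aux:
  fixes Z :: "'a::metric_space set"
  assumes f: "continuous_on Z f" "f ` Z \<subseteq> Z"
    and st1: "stratified S1 R1" and st2: "stratified S2 R2"
    and C1: "openin (top_of_set Z) (S1 \<union> R1)" "closedin (top_of_set Z) (S1 \<union> R1)"
    and C2: "openin (top_of_set Z) (S2 \<union> R2)" "closedin (top_of_set Z) (S2 \<union> R2)"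
    and disj: "(S1 \<union> R1) \<inter> (S2 \<union> R2) = {}"
    and no12: "\<nexists>r. continuous_on (S1 \<union> R1) r \<and> r ` S1 \<subseteq> S2 \<and> r ` R1 \<subseteq> R2"
    and no21: "\<nexists>r. continuous_on (S2 \<union> R2) r \<and> r ` S2 \<subseteq> S1 \<and> r ` R2 \<subseteq> R1"
    and x: "x \<in> S1 \<union> R1"
  shows "alpha_limit (top_of_set Z) f x \<noteq> R1 \<union> R2"
proof
  assume alpha: "alpha_limit (top_of_set Z) f x = R1 \<union> R2"
  have C1Z: "S1 \<union> R1 \<subseteq> Z" and C2Z: "S2 \<union> R2 \<subseteq> Z"
    using C1(2) C2(2) closedin_imp_subset by blast+
  note s1 = stratifiedD[OF st1] and s2 = stratifiedD[OF st2]
  have inv: "f y \<in> R1 \<union> R2" if "y \<in> R1 \<union> R2" for y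
    using alpha_limit_forward_invariant[OF f] that alpha by blast
  have inv_it: "(f ^^ k) y \<in> R1 \<union> R2" if "y \<in> R1 \<union> R2" for k y
    using that inv by (intro funpow_mem) auto
  have near: "\<exists>k\<ge>n. \<exists>z\<in>Z. (f ^^ k) z = x \<and> dist z y < e" if "y \<in> R1 \<union> R2" "e > 0" for y n e
    using that alpha mem_alpha_limit_top_of_set[of y Z f x] by blast
  have conn: "connected (S1 \<union> R1)" "connected (S2 \<union> R2)"
    using stratified_connected[OF st1] stratified_connected[OF st2] .
  have contS: "continuous_on X f" if "X \<subseteq> Z" for X
    using f(1) that continuous_on_subset by blast
  have "alpha_limit (top_of_set Z) f x \<subseteq> (S1 \<union> R1) \<union> (S2 \<union> R2)"
    using alpha by blast
  note comp = image_in_one_component[OF f C1 C2 this]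
  obtain r1 r2 where r1: "r1 \<in> R1" and r2: "r2 \<in> R2"
    using s1 s2 by blast
  have late2: "\<exists>k\<ge>n. \<exists>z\<in>S2 \<union> R2. (f ^^ k) z = x" for n
  proof -
    obtain d where "d > 0" "\<And>z. z \<in> Z \<Longrightarrow> dist z r2 < d \<Longrightarrow> z \<in> S2 \<union> R2"
      using openin_top_of_setD[OF C2(1), of r2] r2 by blast
    then show ?thesis
      using near[of r2 d n] r2 by blast
  qed
  have f2: "f ` (S2 \<union> R2) \<subseteq> S1 \<union> R1"
  proof (rule ccontr)
    assume "\<not> ?thesis"
    then have "f ` (S2 \<union> R2) \<subseteq> S2 \<union> R2"
      using comp[OF conn(2) C2Z, of r2] r2 alpha by blast
    then show False
      using late2[of 0] funpow_mem[of f "S2 \<union> R2"] x disj by blast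
  qed
  have fR2: "f ` R2 \<subseteq> R1"
    using inv f2 disj by blast
  have fS2: "f ` S2 \<subseteq> R1"
  proof -
    have pc2: "path_connected (f ` S2)"
      using s2(3) contS[of S2] C2Z path_connected_continuous_image by blast
    have "f ` S2 \<subseteq> S1 \<or> f ` S2 \<subseteq> R1"
      by (rule stratified_path_connected[OF st1 _ pc2]) (use f2 in blast)
    then show ?thesis
    proof
      assume "f ` S2 \<subseteq> S1"
      then show ?thesis
        using no21 contS[OF C2Z] fR2 by blast
    qed
  qed
  have xR1: "x \<in> R1"
  proof -
    obtain k z where k: "k \<ge> 1" "z \<in> S2 \<union> R2" "(f ^^ k) z = x"
      using late2[of 1] by blast
    then obtain k' where "k = Suc k'"
      by (cases k) auto
    then have "(f ^^ k') (f z) = x"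
      using k(3) by (simp only: funpow_Suc_right o_apply)
    moreover have "f z \<in> R1 \<union> R2"
      using k(2) fR2 fS2 by blast
    ultimately show ?thesis
      using inv_it[of "f z" k'] x disj by auto
  qed
  have f1: "f ` (S1 \<union> R1) \<subseteq> S1 \<union> R1 \<or> f ` (S1 \<union> R1) \<subseteq> S2 \<union> R2"
    using comp[OF conn(1) C1Z, of r1] r1 alpha by blast
  have pc1: "path_connected (f ` S1)"
    using s1(3) contS[of S1] C1Z path_connected_continuous_image by blast
  have fS1: "f ` S1 \<subseteq> R1 \<union> R2 \<or> f ` S1 \<subseteq> S1"
    using f1
  proof
    assume "f ` (S1 \<union> R1) \<subseteq> S1 \<union> R1"
    then have "f ` S1 \<subseteq> S1 \<or> f ` S1 \<subseteq> R1"
      by (intro stratified_path_connected[OF st1 _ pc1]) blast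
    then show ?thesis by blast
  next
    assume *: "f ` (S1 \<union> R1) \<subseteq> S2 \<union> R2"
    then have "f ` S1 \<subseteq> S2 \<or> f ` S1 \<subseteq> R2"
      by (intro stratified_path_connected[OF st2 _ pc1]) blast
    then show ?thesis
    proof
      assume S12: "f ` S1 \<subseteq> S2"
      have "f ` R1 \<subseteq> R2"
        using * inv disj by blast
      then show ?thesis
        using no12 contS[OF C1Z] S12 by blast
    next
      assume "f ` S1 \<subseteq> R2"
      then show ?thesis by blast
    qed
  qed
  \<comment> \<open>A late preimage \<open>z\<close> near \<open>b\<close> may lie on the ray \<open>S1\<close>, but its image does not: if \<open>S1\<close> is not
    mapped into the remainders, it is invariant and its points never reach \<open>x\<close>.\<close>
  have dense: "\<exists>k\<ge>n. \<exists>w\<in>R1 \<union> R2. (f ^^ k) w = x \<and> dist w (f b) < e"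
    if b: "b \<in> R1" and e: "e > 0" for b n e
  proof -
    have bZ: "b \<in> Z" using b C1Z by blast
    obtain d1 where d1: "d1 > 0" "\<And>z. z \<in> Z \<Longrightarrow> dist z b < d1 \<Longrightarrow> dist (f z) (f b) < e"
      using f(1) bZ e unfolding continuous_on_iff by meson
    obtain d2 where d2: "d2 > 0" "\<And>z. z \<in> Z \<Longrightarrow> dist z b < d2 \<Longrightarrow> z \<in> S1 \<union> R1"
      using openin_top_of_setD[OF C1(1), of b] b by blast
    obtain k z where k: "k \<ge> Suc n" "z \<in> Z" "(f ^^ k) z = x" "dist z b < min d1 d2"
      using near[of b "min d1 d2" "Suc n"] b d1(1) d2(1) by auto
    have "f z \<in> R1 \<union> R2"
    proof (cases "z \<in> R1")
      case True
      then show ?thesis using inv by blast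
    next
      case False
      then have "z \<in> S1"
        using d2(2)[OF k(2)] k(4) by auto
      moreover have False if "f ` S1 \<subseteq> S1"
        using funpow_mem[OF that \<open>z \<in> S1\<close>, of k] k(3) xR1 s1(1) by blast
      ultimately show ?thesis
        using fS1 by blast
    qed
    moreover obtain k' where "k = Suc k'"
      using k(1) by (cases k) auto
    moreover from this have "(f ^^ k') (f z) = x"
      using k(3) by (simp only: funpow_Suc_right o_apply)
    moreover have "dist (f z) (f b) < e"
      using d1(2)[OF k(2)] k(4) by simp
    ultimately show ?thesis
      using k(1) by (intro exI[of _ k']) auto
  qed
  have const: "f (f s) = f (f s')" if s: "s \<in> S2" "s' \<in> S2" for s s'
  proof (rule ccontr)
    assume neq: "f (f s) \<noteq> f (f s')"
    obtain g where g: "path g" "path_image g \<subseteq> S2" "pathstart g = s" "pathfinish g = s'"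
      using s2(3) s unfolding path_connected_def by blast
    define D where "D = path_image g"
    have D: "compact D" "connected D" "s \<in> D" "s' \<in> D" "D \<subseteq> S2" "D \<subseteq> Z"
      unfolding D_def using g C2Z compact_path_image connected_path_image
        pathstart_in_path_image[of g] pathfinish_in_path_image[of g] by auto
    have fD: "f ` D \<subseteq> R1"
      using D(5) fS2 by blast
    have "connected (f ` D)"
      using D contS connected_continuous_image by blast
    moreover have "f ` D \<subseteq> Z"
      using fD C1Z by blast
    ultimately have connE: "connected (f ` f ` D)"
      using contS connected_continuous_image by blast
    have "D \<inter> (R1 \<union> R2) = {}"
      using D(5) s2(1) disj by blast
    then obtain n where n: "\<And>k z. k \<ge> n \<Longrightarrow> z \<in> D \<Longrightarrow> (f ^^ k) z \<noteq> x"
      using compact_avoids_late_preimages[OF D(1,6)] alpha by metis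
    have E: False
      if SR: "stratified S R" "openin (top_of_set Z) (S \<union> R)" "f ` f ` D \<subseteq> R"
        "(R1 \<union> R2) \<inter> (S \<union> R) \<subseteq> R" for S R
    proof -
      obtain e d where ed: "e \<in> f ` f ` D" "d > 0" "ball e d \<inter> R \<subseteq> f ` f ` D"
        using stratified_interior[OF SR(1) SR(3) connE, of "f (f s)" "f (f s')"] D(3,4) neq by blast
      then obtain b where b: "b \<in> R1" "e = f b"
        using fD by blast
      have "e \<in> S \<union> R"
        using ed(1) SR(3) by blast
      then obtain d' where d': "d' > 0" "\<And>z. z \<in> Z \<Longrightarrow> dist z e < d' \<Longrightarrow> z \<in> S \<union> R"
        using openin_top_of_setD[OF SR(2)] by metis
      obtain k w where k: "k \<ge> n" "w \<in> R1 \<union> R2" "(f ^^ k) w = x" "dist w e < min d d'"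
        using dense[OF b(1), of "min d d'" n] ed(2) d'(1) b(2) by auto
      have "w \<in> Z"
        using k(2) C1Z C2Z by blast
      then have "w \<in> ball e d \<inter> R"
        using d'(2)[of w] k(2,4) SR(4) by (auto simp: dist_commute)
      then obtain z where z: "z \<in> D" "w = f (f z)"
        using ed(3) by blast
      then have "(f ^^ Suc (Suc k)) z = x"
        using k(3) by (simp only: funpow_Suc_right o_apply)
      then show False
        using n[of "Suc (Suc k)" z] k(1) z(1) by auto
    qed
    show False
      using f1
    proof
      assume "f ` (S1 \<union> R1) \<subseteq> S1 \<union> R1"
      then have "f ` f ` D \<subseteq> R1"
        using inv fD disj by blast
      then show False
        using E[OF st1 C1(1)] disj by blast
    next
      assume "f ` (S1 \<union> R1) \<subseteq> S2 \<union> R2"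
      then have "f ` f ` D \<subseteq> R2"
        using inv fD disj by blast
      then show False
        using E[OF st2 C2(1)] disj by blast
    qed
  qed
  have "S2 \<noteq> {}"
    using s2 by auto
  then obtain s where s: "s \<in> S2" by blast
  have const2: "f (f y) = f (f s)" if y: "y \<in> S2 \<union> R2" for y
  proof -
    define K where "K = {y \<in> S2 \<union> R2. f (f y) = f (f s)}"
    have "continuous_on (S2 \<union> R2) (\<lambda>y. f (f y))"
      using f2 C1Z by (intro continuous_on_compose2[OF f(1) contS[OF C2Z]]) blast
    then have "closedin (top_of_set (S2 \<union> R2)) K"
      unfolding K_def by (rule continuous_closedin_preimage_constant)
    moreover have "S2 \<subseteq> K"
      unfolding K_def using const s by blast
    then have "closure S2 \<subseteq> closure K"
      by (rule closure_mono)
    then have "y \<in> closure K"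
      using y s2(4) closure_subset[of S2] by blast
    ultimately have "y \<in> K"
      using closedin_top_of_set_closure y by metis
    then show ?thesis
      by (simp add: K_def)
  qed
  have "s \<in> alpha_limit (top_of_set Z) f x"
    unfolding mem_alpha_limit_top_of_set
  proof (intro conjI allI impI)
    show "s \<in> Z" using s C2Z by blast
    fix n :: nat and e :: real assume "e > 0"
    obtain k z where k: "k \<ge> Suc (Suc n)" "z \<in> S2 \<union> R2" "(f ^^ k) z = x"
      using late2 by blast
    define k' where "k' = k - 2"
    have k': "k = Suc (Suc k')"
      using k(1) by (simp add: k'_def)
    have "(f ^^ k) s = (f ^^ k) z"
      unfolding k' by (simp only: funpow_Suc_right o_apply const2[OF k(2)])
    then show "\<exists>k\<ge>n. \<exists>z\<in>Z. (f ^^ k) z = x \<and> dist z s < e"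
      using k \<open>s \<in> Z\<close> \<open>e > 0\<close> by (intro exI[of _ k]) auto
  qed
  then show False
    using alpha s s2(1) disj by blast
qed

text \<open>
  By forward invariance, points of the two components never leave them, so \<open>x\<close> lies in one
  of them, and the situation is symmetric.
\<close>

lemma alpha_limit_not_both_remainders:
  fixes Z :: "'a::metric_space set"
  assumes f: "continuous_on Z f" "f ` Z \<subseteq> Z"
    and st1: "stratified S1 R1" and st2: "stratified S2 R2"
    and C1: "openin (top_of_set Z) (S1 \<union> R1)" "closedin (top_of_set Z) (S1 \<union> R1)"
    and C2: "openin (top_of_set Z) (S2 \<union> R2)" "closedin (top_of_set Z) (S2 \<union> R2)"
    and disj: "(S1 \<union> R1) \<inter> (S2 \<union> R2) = {}"
    and no12: "\<nexists>r. continuous_on (S1 \<union> R1) r \<and> r ` S1 \<subseteq> S2 \<and> r ` R1 \<subseteq> R2"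
    and no21: "\<nexists>r. continuous_on (S2 \<union> R2) r \<and> r ` S2 \<subseteq> S1 \<and> r ` R2 \<subseteq> R1"
  shows "alpha_limit (top_of_set Z) f x \<noteq> R1 \<union> R2"
proof
  assume alpha: "alpha_limit (top_of_set Z) f x = R1 \<union> R2"
  define C where "C = (S1 \<union> R1) \<union> (S2 \<union> R2)"
  obtain r1 r2 where r: "r1 \<in> R1" "r2 \<in> R2"
    using stratifiedD(2)[OF st1] stratifiedD(2)[OF st2] by blast
  have "alpha_limit (top_of_set Z) f x \<subseteq> (S1 \<union> R1) \<union> (S2 \<union> R2)"
    using alpha by blast
  note comp = image_in_one_component[OF f C1 C2 this]
  have "f ` (S1 \<union> R1) \<subseteq> C"
    unfolding C_def
    using comp[OF stratified_connected[OF st1] closedin_imp_subset[OF C1(2)], of r1] r alpha by blast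
  moreover have "f ` (S2 \<union> R2) \<subseteq> C"
    unfolding C_def
    using comp[OF stratified_connected[OF st2] closedin_imp_subset[OF C2(2)], of r2] r alpha by blast
  ultimately have fC: "f ` C \<subseteq> C"
    unfolding C_def by (simp add: image_Un)
  obtain d where d: "d > 0" "\<And>z. z \<in> Z \<Longrightarrow> dist z r1 < d \<Longrightarrow> z \<in> S1 \<union> R1"
    using openin_top_of_setD[OF C1(1), of r1] r by blast
  have "r1 \<in> alpha_limit (top_of_set Z) f x"
    using alpha r by blast
  then obtain k z where k: "z \<in> Z" "(f ^^ k) z = x" "dist z r1 < d"
    using d(1) unfolding mem_alpha_limit_top_of_set by meson
  have "z \<in> C"
    using d(2)[OF k(1,3)] by (auto simp: C_def)
  then have "x \<in> C"
    using funpow_mem[OF fC] k(2) by blast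
  then consider "x \<in> S1 \<union> R1" | "x \<in> S2 \<union> R2"
    unfolding C_def by blast
  then show False
  proof cases
    case 1
    then show ?thesis
      using alpha_limit_not_both_remainders_aux[OF f st1 st2 C1 C2 disj no12 no21 1] alpha by simp
  next
    case 2
    have "(S2 \<union> R2) \<inter> (S1 \<union> R1) = {}"
      using disj by blast
    from alpha_limit_not_both_remainders_aux[OF f st2 st1 C2 C1 this no21 no12 2] show ?thesis
      using alpha by (simp add: Un_commute)
  qed
qed

section \<open>The spiral and the zigzag\<close>

lemma dist_cis_le: "dist (cis a) (cis b) \<le> \<bar>a - b\<bar>"
proof -
  have "(dist (cis a) (cis b))\<^sup>2 = (cos a - cos b)\<^sup>2 + (sin a - sin b)\<^sup>2"
    by (simp add: dist_norm cmod_power2)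
  also have "\<dots> = 2 - 2 * cos (a - b)"
    using sin_cos_squared_add[of a] sin_cos_squared_add[of b]
    by (simp add: cos_diff power2_eq_square algebra_simps)
  also have "\<dots> = (2 * sin ((a - b) / 2))\<^sup>2"
  proof -
    have half: "2 * ((a - b) / 2) = a - b"
      by simp
    have "cos (a - b) = 1 - 2 * (sin ((a - b) / 2))\<^sup>2"
      using cos_double_sin[of "(a - b) / 2"] unfolding half .
    then show ?thesis
      by (simp add: power_mult_distrib)
  qed
  also have "\<dots> \<le> \<bar>a - b\<bar>\<^sup>2"
    using abs_sin_x_le_abs_x[of "(a - b) / 2"] by (intro power2_le_iff_abs_le[THEN iffD2]) auto
  finally show ?thesis
    by (rule power2_le_imp_le) simp
qed

text \<open>
  Adding turns to the argument of \<open>b\<close> makes it as large as desired.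
\<close>

lemma cis_arbitrarily_late:
  assumes "norm b = 1"
  shows "\<exists>u\<ge>M. cis u = b"
proof -
  obtain n :: nat where n: "real n > M - Arg b"
    using reals_Archimedean2 by blast
  have "real n \<le> 2 * pi * real n"
    using pi_gt3 by (intro mult_right_mono[of 1 "2 * pi", simplified]) auto
  then have "Arg b + 2 * pi * real n \<ge> M"
    using n by linarith
  moreover have "cis (Arg b + 2 * pi * real n) = b"
  proof -
    have "cis (Arg b) = b"
      using assms cis_Arg[of b] by (cases "b = 0") (auto simp: sgn_div_norm)
    moreover have "cis (2 * pi * real n) = 1"
      by (rule cis_multiple_2pi) simp
    ultimately show ?thesis
      by (simp add: cis_mult[symmetric])
  qed
  ultimately show ?thesis by blast
qed

text \<open>
  The first space: a spiral winding onto the unit circle. Doubling the parameter is squaring on the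
  circle, and the backward orbit of \<open>1\<close> consists of the roots of unity whose order is a power of two.
\<close>

interpretation spiral: expanding_ray cis "sphere 0 1" "\<lambda>z. z\<^sup>2" 1
proof
  show "continuous_on {1..} cis"
    by (intro continuous_intros)
  show "cis u \<in> sphere 0 1" for u
    by simp
  show "\<exists>u\<ge>M. cis u = b" if "b \<in> sphere 0 1" for b M
    using that cis_arbitrarily_late by simp
  show "compact (sphere (0::complex) 1)"
    by simp
  show "path_connected (sphere (0::complex) 1)"
    by (intro path_connected_sphere) simp
  show "\<exists>b\<in>sphere 0 1. b \<noteq> c" for c :: complex
    by (cases "c = 1") (auto intro: bexI[of _ 1] bexI[of _ "-1"])
  show "\<exists>\<phi>::complex \<Rightarrow> real. continuous_on (sphere 0 1 - {w}) \<phi> \<and> inj_on \<phi> (sphere 0 1 - {w})"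
    if w: "w \<in> sphere 0 1" for w
  proof (intro exI conjI)
    have w0: "w \<noteq> 0" "norm w = 1" using w by auto
    have "z / w \<notin> \<real>\<^sub>\<ge>\<^sub>0" if "z \<in> sphere 0 1 - {w}" for z
    proof
      assume "z / w \<in> \<real>\<^sub>\<ge>\<^sub>0"
      then obtain r where r: "r \<ge> 0" "z / w = of_real r"
        by (metis nonneg_Reals_cases)
      have "norm (z / w) = 1"
        using that w0 by (simp add: norm_divide)
      then have "r = 1"
        using r by simp
      then show False
        using r(2) that w0 by simp
    qed
    then show "continuous_on (sphere 0 1 - {w}) (\<lambda>z. Arg2pi (z / w))"
      using w0 by (intro continuous_at_imp_continuous_on ballI
          continuous_at_compose[of _ "\<lambda>z. z / w" Arg2pi, unfolded o_def] continuous_at_Arg2pi)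
        (auto intro!: continuous_intros)
    show "inj_on (\<lambda>z. Arg2pi (z / w)) (sphere 0 1 - {w})"
    proof (rule inj_onI)
      fix y z assume yz: "y \<in> sphere 0 1 - {w}" "z \<in> sphere 0 1 - {w}" "Arg2pi (y / w) = Arg2pi (z / w)"
      then have "norm (y / w) = norm (z / w)"
        using w0 by (simp add: norm_divide)
      then have "y / w = z / w"
        using yz(3) Arg2pi_eq[of "y / w"] Arg2pi_eq[of "z / w"] by metis
      then show "y = z"
        using w0 by simp
    qed
  qed
  show "continuous_on (sphere 0 1) (\<lambda>z::complex. z\<^sup>2)"
    by (intro continuous_intros)
  show "b\<^sup>2 \<in> sphere 0 1" if "b \<in> sphere 0 1" for b :: complex
    using that by (simp add: norm_power)
  show "cis (2 * u) = (cis u)\<^sup>2" for u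
    by (simp add: Complex.DeMoivre)
  show "(1::complex) \<in> sphere 0 1" "(1::complex)\<^sup>2 = 1"
    by simp_all
  fix b :: complex and e :: real assume b: "b \<in> sphere 0 1" and e: "e > 0"
  obtain u where u: "u \<ge> 0" "cis u = b"
    using cis_arbitrarily_late[of b 0] b by auto
  obtain k where k: "2 * pi / e < 2 ^ k"
    using real_arch_pow[of 2] by auto
  define q where "q = 2 * pi / 2 ^ k"
  have q: "q > 0" "q < e"
    using k e by (simp_all add: q_def field_simps)
  define j where "j = nat \<lfloor>u / q\<rfloor>"
  have j: "real j \<le> u / q" "u / q < real j + 1"
  proof -
    have "u / q \<ge> 0"
      using u(1) q(1) by simp
    then have "real j = of_int \<lfloor>u / q\<rfloor>"
      by (simp add: j_def)
    then show "real j \<le> u / q" "u / q < real j + 1"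
      by linarith+
  qed
  have "\<bar>real j * q - u\<bar> < e"
  proof -
    have "real j * q \<le> u" "u < real j * q + q"
      using j q(1) by (simp_all add: field_simps)
    then show ?thesis using q(2) by linarith
  qed
  then have close: "dist (cis (real j * q)) b < e"
    using dist_cis_le[of "real j * q" u] u(2) by simp
  have "((\<lambda>z. z\<^sup>2) ^^ n) z = z ^ (2 ^ n)" for n and z :: complex
    by (induction n) (simp_all add: power_mult[symmetric] mult.commute)
  then have "((\<lambda>z. z\<^sup>2) ^^ k) (cis (real j * q)) = cis (2 ^ k * (real j * q))"
    by (simp add: Complex.DeMoivre)
  also have "2 ^ k * (real j * q) = 2 * pi * real j"
    by (simp add: q_def)
  also have "cis (2 * pi * real j) = 1"
    by (rule cis_multiple_2pi) simp
  finally have "((\<lambda>z. z\<^sup>2) ^^ k) (cis (real j * q)) = 1" .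
  with close show "\<exists>k. \<exists>d\<in>sphere 0 1. ((\<lambda>z. z\<^sup>2) ^^ k) d = 1 \<and> dist d b < e"
    by (intro exI[of _ k] bexI[of _ "cis (real j * q)"]) auto
qed

text \<open>
  A piecewise linear self-map of \<open>[-1, 1]\<close>. It is the tent map on \<open>[-1, 0]\<close>, which is invariant, and
  its graph on \<open>[0, 1]\<close> climbs from \<open>0\<close> to \<open>1\<close> and then falls to \<open>-1\<close>.
\<close>

definition bend :: "real \<Rightarrow> real" where
  "bend t = max (- 2 - 2 * t) (min (2 * t) (3 - 4 * t))"

text \<open>
  The oscillating height function of the second ray, obtained by unfolding the slope \<open>2\<close> of \<open>bend\<close> at
  its fixed point \<open>0\<close>: it is the identity on \<open>[0, 1]\<close> and satisfies \<open>zig (2 u) = bend (zig u)\<close>.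
  The number of iterations need only be large enough to bring \<open>u / 2 ^ n\<close> into \<open>[0, 1]\<close>.
\<close>

definition zig :: "real \<Rightarrow> real" where
  "zig u = (bend ^^ nat \<lceil>u\<rceil>) (u / 2 ^ nat \<lceil>u\<rceil>)"

lemma bend_in: "t \<in> {-1..1} \<Longrightarrow> bend t \<in> {-1..1}"
  by (auto simp: bend_def max_def min_def)

lemma continuous_on_bend: "continuous_on X bend"
  unfolding bend_def by (intro continuous_intros)

lemma bend_center: "\<bar>t\<bar> \<le> 1 / 2 \<Longrightarrow> bend t = 2 * t"
  by (auto simp: bend_def max_def min_def)

lemma bend_right: "1 / 2 \<le> t \<Longrightarrow> t \<le> 1 \<Longrightarrow> bend t = 3 - 4 * t"
  by (auto simp: bend_def max_def min_def)

lemma zig_eq: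
  assumes "0 \<le> u" "u \<le> real n"
  shows "zig u = (bend ^^ n) (u / 2 ^ n)"
proof -
  define m where "m = nat \<lceil>u\<rceil>"
  have um: "u \<le> real m" and mn: "m \<le> n"
    using assms by (auto simp: m_def real_nat_ceiling_ge nat_le_iff ceiling_le_iff)
  from mn have "(bend ^^ n) (u / 2 ^ n) = (bend ^^ m) (u / 2 ^ m)"
  proof (induction n rule: dec_induct)
    case (step n)
    have "real n < 2 ^ n"
      by (metis of_nat_less_two_power)
    then have "u \<le> 2 ^ n"
      using um step(1) by linarith
    then have "u / 2 ^ n \<le> 1"
      by simp
    then have "bend (u / 2 ^ Suc n) = u / 2 ^ n"
      using assms(1) by (subst bend_center) (auto simp: field_simps)
    then show ?case
      using step by (simp only: funpow_Suc_right o_apply)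
  qed simp
  then show ?thesis
    by (simp add: zig_def m_def)
qed

lemma zig_double: "0 \<le> u \<Longrightarrow> zig (2 * u) = bend (zig u)"
proof -
  assume u: "0 \<le> u"
  obtain n :: nat where n: "2 * u \<le> real n"
    using real_arch_simple by blast
  have "zig (2 * u) = (bend ^^ Suc n) (2 * u / 2 ^ Suc n)"
    using u n by (intro zig_eq) auto
  also have "\<dots> = bend ((bend ^^ n) (u / 2 ^ n))"
    by simp
  also have "(bend ^^ n) (u / 2 ^ n) = zig u"
    using u n by (intro zig_eq[symmetric]) auto
  finally show ?thesis .
qed

lemma zig_in: "0 \<le> u \<Longrightarrow> zig u \<in> {-1..1}"
proof -
  assume u: "0 \<le> u"
  obtain n :: nat where n: "u \<le> real n"
    using real_arch_simple by blast
  have "real n < 2 ^ n"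
    by (metis of_nat_less_two_power)
  then have "u \<le> 2 ^ n"
    using n by linarith
  then have "0 \<le> u / 2 ^ n" "u / 2 ^ n \<le> 1"
    using u by simp_all
  then have "u / 2 ^ n \<in> {-1..1}"
    by simp
  then show ?thesis
    unfolding zig_eq[OF u n] using bend_in by (intro funpow_mem) auto
qed

lemma continuous_on_zig: "continuous_on {0<..} zig"
proof -
  have "continuous_on (\<Union>n. {0<..<real n}) zig"
  proof (rule continuous_on_open_UN)
    fix n :: nat
    have "continuous_on X (\<lambda>u. (bend ^^ k) (u / 2 ^ m))" for X :: "real set" and k m
    proof (induction k)
      case (Suc k)
      then show ?case
        using continuous_on_compose2[OF continuous_on_bend[of UNIV] Suc] by simp
    qed (auto intro!: continuous_intros)
    from this[of "{0<..<real n}" n n] show "continuous_on {0<..<real n} zig"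
      by (rule continuous_on_eq) (simp add: zig_eq[of _ n])
  qed auto
  moreover have "(\<Union>n. {0<..<real n}) = {0<..}"
    using reals_Archimedean2 by fastforce
  ultimately show ?thesis by simp
qed

lemma zig_base:
  assumes "\<bar>s\<bar> \<le> 1"
  shows "zig (3 + s) = bend (- s)"
proof -
  have "zig ((3 + s) / 4) = (3 + s) / 4"
    using assms zig_eq[of "(3 + s) / 4" 1] bend_center[of "(3 + s) / 4 / 2"] by (simp add: abs_le_iff)
  moreover have "bend ((3 + s) / 4) = - s"
    using assms bend_right[of "(3 + s) / 4"] by (simp add: abs_le_iff field_simps)
  moreover have "2 * ((3 + s) / 4) = (3 + s) / 2" "2 * ((3 + s) / 2) = 3 + s"
    by simp_all
  moreover have "0 \<le> (3 + s) / 4" "0 \<le> (3 + s) / 2"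
    using assms by auto
  ultimately show ?thesis
    using zig_double by metis
qed

text \<open>
  Within distance \<open>1 / 2\<close> of each point \<open>3 * 2 ^ k\<close>, the function descends from \<open>1\<close> through \<open>0\<close> to \<open>-1\<close>. In particular it
  takes every value of \<open>[-1, 1]\<close> arbitrarily late.
\<close>

lemma zig_near_crossing: "\<bar>s\<bar> \<le> 1 \<Longrightarrow> zig (3 * 2 ^ k + s) = bend (- s)"
proof (induction k arbitrary: s)
  case 0
  then show ?case using zig_base by simp
next
  case (Suc k)
  have "(0::real) \<le> 3 * 2 ^ k + s / 2"
    using Suc.prems one_le_power[of "2::real" k] by linarith
  then have "zig (3 * 2 ^ Suc k + s) = bend (zig (3 * 2 ^ k + s / 2))"
    using zig_double[of "3 * 2 ^ k + s / 2"] by simp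
  also have "zig (3 * 2 ^ k + s / 2) = bend (- s / 2)"
    using Suc.IH[of "s / 2"] Suc.prems by simp
  also have "bend (- s / 2) = - s"
    using Suc.prems by (subst bend_center) auto
  finally show ?case .
qed

lemma zig_arbitrarily_late:
  assumes "b \<in> {-1..1}"
  shows "\<exists>u\<ge>M. zig u = b"
proof -
  obtain k where k: "M + 1 < 2 ^ k"
    using real_arch_pow[of 2 "M + 1"] by auto
  have "\<bar>b\<bar> \<le> 1"
    using assms by auto
  then have "zig (3 * 2 ^ k + (- b / 2)) = b"
    using zig_near_crossing[of "- b / 2" k] bend_center[of "b / 2"] by simp
  moreover have "3 * 2 ^ k + (- b / 2) \<ge> M"
  proof -
    have "(2::real) ^ k > 0"
      by simp
    then show ?thesis
      using k \<open>\<bar>b\<bar> \<le> 1\<close> by linarith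
  qed
  ultimately show ?thesis by blast
qed

text \<open>
  The stretch from \<open>3 * 2 ^ k\<close> to \<open>4 * 2 ^ k\<close> consists of \<open>2 ^ k\<close> identical dips from \<open>0\<close> to \<open>-1\<close> and back, since
  the tent map doubles their number from one \<open>k\<close> to the next. These ever longer runs make the
  oscillation aperiodic.
\<close>

lemma zig_run:
  "0 \<le> s \<Longrightarrow> s \<le> 2 ^ k \<Longrightarrow> zig (3 * 2 ^ k + s) = bend (- frac s)"
proof (induction k arbitrary: s)
  case 0
  then have "zig (3 + s) = bend (- s)"
    by (intro zig_base) auto
  moreover have "s = 1 \<or> frac s = s"
    using 0 by (auto simp: frac_eq)
  moreover have "bend (- 1) = bend 0"
    by (simp add: bend_def)
  ultimately show ?case by auto
next
  case (Suc k)
  define f where "f = frac (s / 2)"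
  have f: "0 \<le> f" "f < 1"
    by (auto simp: f_def frac_lt_1)
  have s: "s = 2 * f + 2 * of_int \<lfloor>s / 2\<rfloor>"
    by (simp add: f_def frac_def)
  have "zig (3 * 2 ^ Suc k + s) = bend (zig (3 * 2 ^ k + s / 2))"
    using zig_double[of "3 * 2 ^ k + s / 2"] Suc.prems by simp
  also have "zig (3 * 2 ^ k + s / 2) = bend (- f)"
    using Suc.IH[of "s / 2"] Suc.prems by (simp add: f_def)
  also have "bend (bend (- f)) = bend (- frac s)"
  proof (cases "f < 1 / 2")
    case True
    have "s - 2 * f = of_int (2 * \<lfloor>s / 2\<rfloor>)"
      using s by simp
    then have "s - 2 * f \<in> \<int>"
      by (simp only: Ints_of_int)
    then have "frac s = 2 * f"
      unfolding frac_unique_iff using True f by simp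
    then show ?thesis
      using True f by (simp add: bend_center)
  next
    case False
    have "s - (2 * f - 1) = of_int (2 * \<lfloor>s / 2\<rfloor> + 1)"
      using s by simp
    then have "s - (2 * f - 1) \<in> \<int>"
      by (simp only: Ints_of_int)
    then have "frac s = 2 * f - 1"
      unfolding frac_unique_iff using False f by simp
    then show ?thesis
      using False f by (auto simp: bend_def max_def min_def)
  qed
  finally show ?case .
qed

text \<open>
  Every branch of \<open>bend\<close> expands by a factor of at least \<open>2\<close>, so pulling an approximation of \<open>bend y\<close>
  back along the branch at \<open>y\<close> halves the error. Approximating from the same side of \<open>0\<close> keeps the
  approximation within the range of the branch.
\<close>

lemma dense_preimages_bend:
  "(\<forall>y\<in>{-1..0}. \<exists>k. \<exists>d\<in>{-1..0}. (bend ^^ k) d = 0 \<and> \<bar>d - y\<bar> \<le> 1 / 2 ^ n) \<and>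
   (\<forall>y\<in>{0..1}. \<exists>k. \<exists>d\<in>{0..1}. (bend ^^ k) d = 0 \<and> \<bar>d - y\<bar> \<le> 1 / 2 ^ n)"
proof (induction n)
  case 0
  have "(bend ^^ 0) 0 = 0" by simp
  then show ?case
    by (intro conjI ballI exI[of _ 0] bexI[of _ 0]) auto
next
  case (Suc n)
  have pull: "\<exists>k. \<exists>d\<in>I. (bend ^^ k) d = 0 \<and> \<bar>d - y\<bar> \<le> 1 / 2 ^ Suc n"
    if "bend d' = d" "d' \<in> I" "2 * \<bar>d' - y\<bar> \<le> \<bar>d - bend y\<bar>"
      "(bend ^^ k) d = 0" "\<bar>d - bend y\<bar> \<le> 1 / 2 ^ n" for d d' I y k
  proof -
    have "(bend ^^ Suc k) d' = 0"
      using that(1,4) by (simp only: funpow_Suc_right o_apply)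
    moreover have "\<bar>d' - y\<bar> \<le> 1 / 2 ^ Suc n"
      using that(3,5) by simp
    ultimately show ?thesis
      using that(2) by blast
  qed
  have neg: "\<exists>k. \<exists>d\<in>{-1..0}. (bend ^^ k) d = 0 \<and> \<bar>d - y\<bar> \<le> 1 / 2 ^ n" if "-1 \<le> y" "y \<le> 0" for y
    using Suc that by auto
  have pos: "\<exists>k. \<exists>d\<in>{0..1}. (bend ^^ k) d = 0 \<and> \<bar>d - y\<bar> \<le> 1 / 2 ^ n" if "0 \<le> y" "y \<le> 1" for y
    using Suc that by auto
  show ?case
  proof (intro conjI ballI)
    fix y :: real assume y: "y \<in> {-1..0}"
    have "bend y \<in> {-1..0}"
      using y by (auto simp: bend_def max_def min_def)
    then obtain k d where d: "d \<in> {-1..0}" "(bend ^^ k) d = 0" "\<bar>d - bend y\<bar> \<le> 1 / 2 ^ n"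
      using neg[of "bend y"] by auto
    show "\<exists>k. \<exists>d\<in>{-1..0}. (bend ^^ k) d = 0 \<and> \<bar>d - y\<bar> \<le> 1 / 2 ^ Suc n"
    proof (cases "y \<ge> - 1 / 2")
      case True
      show ?thesis
        by (rule pull[of "d / 2" d _ y k]) (use d y True in \<open>auto simp: bend_center abs_if field_simps\<close>)
    next
      case False
      show ?thesis
        by (rule pull[of "- 1 - d / 2" d _ y k])
          (use d y False in \<open>auto simp: bend_def max_def min_def abs_if field_simps\<close>)
    qed
  next
    fix y :: real assume y: "y \<in> {0..1}"
    show "\<exists>k. \<exists>d\<in>{0..1}. (bend ^^ k) d = 0 \<and> \<bar>d - y\<bar> \<le> 1 / 2 ^ Suc n"
    proof (cases "y \<le> 1 / 2")
      case True
      then have "bend y \<in> {0..1}"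
        using y by (auto simp: bend_center)
      then obtain k d where d: "d \<in> {0..1}" "(bend ^^ k) d = 0" "\<bar>d - bend y\<bar> \<le> 1 / 2 ^ n"
        using pos[of "bend y"] by auto
      show ?thesis
        by (rule pull[of "d / 2" d _ y k]) (use d y True in \<open>auto simp: bend_center abs_if field_simps\<close>)
    next
      case False
      have by': "bend y = 3 - 4 * y"
        using False y by (auto simp: bend_def max_def min_def)
      have "\<exists>k. \<exists>d\<in>{-1..1}. (bend ^^ k) d = 0 \<and> \<bar>d - bend y\<bar> \<le> 1 / 2 ^ n"
        using pos[of "bend y"] neg[of "bend y"] y False unfolding by' by fastforce
      then obtain k d where d: "d \<in> {-1..1}" "(bend ^^ k) d = 0" "\<bar>d - bend y\<bar> \<le> 1 / 2 ^ n"
        by auto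
      \<comment> \<open>the steep branch covers all of \<open>[-1, 1]\<close>\<close>
      have "bend ((3 - d) / 4) = d"
        using d(1) by (auto simp: bend_def max_def min_def field_simps)
      then show ?thesis
        by (rule pull[of "(3 - d) / 4" d _ y k])
          (use d y in \<open>auto simp: by' abs_if field_simps\<close>)
    qed
  qed
qed

text \<open>
  The second space: a ray oscillating with height \<open>zig\<close> in front of an arc.
\<close>

interpretation zigzag: expanding_ray "\<lambda>u. of_real (zig u)" "of_real ` {-1..1}"
    "\<lambda>z. of_real (bend (Re z))" 0
proof
  show "continuous_on {1..} (\<lambda>u. complex_of_real (zig u))"
    by (intro continuous_on_of_real continuous_on_subset[OF continuous_on_zig]) auto
  show "complex_of_real (zig u) \<in> of_real ` {-1..1}" if "1 \<le> u" for u
    using zig_in[of u] that by (intro imageI) simp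
  show "\<exists>u\<ge>M. complex_of_real (zig u) = b" if "b \<in> of_real ` {-1..1}" for b M
    using that zig_arbitrarily_late by force
  show "compact (complex_of_real ` {-1..1})"
    by (intro compact_continuous_image continuous_intros compact_Icc)
  show "path_connected (complex_of_real ` {-1..1})"
    by (intro path_connected_continuous_image continuous_intros convex_imp_path_connected) auto
  show "\<exists>b\<in>of_real ` {-1..1}. b \<noteq> c" for c :: complex
    by (cases "c = 0") (auto intro: bexI[of _ 1] bexI[of _ 0])
  show "\<exists>\<phi>::complex \<Rightarrow> real. continuous_on (of_real ` {-1..1} - {w}) \<phi> \<and> inj_on \<phi> (of_real ` {-1..1} - {w})" for w
    by (intro exI[of _ Re]) (auto intro!: continuous_intros inj_onI)
  show "continuous_on (of_real ` {-1..1}) (\<lambda>z. complex_of_real (bend (Re z)))"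
    by (intro continuous_on_of_real continuous_on_compose2[OF continuous_on_bend[of UNIV]] continuous_intros) auto
  show "complex_of_real (bend (Re b)) \<in> of_real ` {-1..1}" if "b \<in> of_real ` {-1..1}" for b
    using that bend_in by (intro imageI) auto
  show "complex_of_real (zig (2 * u)) = of_real (bend (Re (of_real (zig u))))" if "1 \<le> u" for u
    using zig_double[of u] that by simp
  show "0 \<in> complex_of_real ` {-1..1}" "complex_of_real (bend (Re 0)) = 0"
    by (auto simp: bend_center intro!: image_eqI[of _ _ 0])
  fix b :: complex and e :: real assume b: "b \<in> of_real ` {-1..1}" and e: "e > 0"
  then obtain y where y: "b = of_real y" "y \<in> {-1..1}"
    by blast
  obtain n where n: "1 / e < 2 ^ n"
    using real_arch_pow[of 2] by auto
  have n': "1 / 2 ^ n < e"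
    using n e by (simp add: field_simps)
  have "\<exists>k. \<exists>d\<in>{-1..1}. (bend ^^ k) d = 0 \<and> \<bar>d - y\<bar> \<le> 1 / 2 ^ n"
    using dense_preimages_bend[of n] y(2) by (cases "y \<le> 0") fastforce+
  then obtain k d where d: "d \<in> {-1..1}" "(bend ^^ k) d = 0" "\<bar>d - y\<bar> \<le> 1 / 2 ^ n"
    by blast
  have "((\<lambda>z. complex_of_real (bend (Re z))) ^^ k) (of_real d) = of_real ((bend ^^ k) d)" for k
    by (induction k) auto
  moreover have "dist (complex_of_real d) b < e"
    using d(3) n' unfolding y(1) dist_of_real by (simp add: dist_real_def)
  ultimately show "\<exists>k. \<exists>d\<in>of_real ` {-1..1}.
      ((\<lambda>z. complex_of_real (bend (Re z))) ^^ k) d = 0 \<and> dist d b < e"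
    using d(1,2) by (intro exI[of _ k] bexI[of _ "of_real d"]) auto
qed

section \<open>The two rays are incomparable\<close>

text \<open>
  By uniform continuity, a map taking remainder to remainder is determined far out on the ray, up to a
  small error, by its values on the remainder.
\<close>

lemma (in recurrent_ray) map_close_to_remainder:
  fixes r :: "real \<times> complex \<Rightarrow> real \<times> complex"
  assumes "continuous_on (ray h \<union> remainder B) r" "r ` remainder B \<subseteq> remainder B'" "e > 0"
  shows "\<exists>U\<ge>1. \<forall>u\<ge>U. dist (r (1 / u, h u)) (r (0, h u)) < e \<and> fst (r (1 / u, h u)) < e"
proof -
  have "uniformly_continuous_on (ray h \<union> remainder B) r"
    using assms(1) compact_ray_remainder compact_uniformly_continuous by blast
  then obtain d where d: "d > 0" "\<And>y z. y \<in> ray h \<union> remainder B \<Longrightarrow> z \<in> ray h \<union> remainder B \<Longrightarrow>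
      dist z y < d \<Longrightarrow> dist (r z) (r y) < e"
    using assms(3) unfolding uniformly_continuous_on_def by meson
  define U where "U = max 1 (2 / d)"
  have close: "dist (r (1 / u, h u)) (r (0, h u)) < e" if u: "u \<ge> U" for u
  proof -
    have u1: "u \<ge> 1" "u \<ge> 2 / d"
      using u by (auto simp: U_def)
    then have "2 \<le> u * d"
      using d(1) by (simp add: field_simps)
    then have "1 / u < d"
      using u1 by (simp add: field_simps)
    moreover have "dist (1 / u, h u) (0, h u) = 1 / u"
      using u1 by (simp add: dist_Pair_Pair)
    moreover have "(1 / u, h u) \<in> ray h" "(0, h u) \<in> remainder B"
      using ray_point u1 h_in_B by (auto simp: remainder_def)
    ultimately show ?thesis
      using d(2)[of "(0, h u)" "(1 / u, h u)"] by simp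
  qed
  moreover have "fst (r (1 / u, h u)) < e" if u: "u \<ge> U" for u
  proof -
    have "(0, h u) \<in> remainder B"
      using u h_in_B by (simp add: U_def remainder_def)
    then have "r (0, h u) \<in> remainder B'"
      using assms(2) by blast
    then have "fst (r (0, h u)) = 0"
      by (auto simp: remainder_def)
    then show ?thesis
      using close[OF u] dist_fst_le[of "r (1 / u, h u)" "r (0, h u)"] by (simp add: dist_real_def)
  qed
  moreover have "U \<ge> 1"
    by (simp add: U_def)
  ultimately show ?thesis by blast
qed

text \<open>
  On the arc, the map into the circle has a continuous argument, which is bounded. Far out on the ray
  the angle \<open>F\<close> of the image differs from this argument by almost a multiple of \<open>2 * pi\<close>, hence by a bounded
  amount; but \<open>F\<close> tends to infinity.
\<close>

lemma no_map_zigzag_to_spiral: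
  fixes r :: "real \<times> complex \<Rightarrow> real \<times> complex"
  assumes r: "continuous_on (ray (\<lambda>u. of_real (zig u)) \<union> remainder (of_real ` {-1..1})) r"
    "r ` ray (\<lambda>u. of_real (zig u)) \<subseteq> ray cis"
    "r ` remainder (of_real ` {-1..1}) \<subseteq> remainder (sphere 0 1)"
  shows False
proof -
  define P where "P u = (1 / u, complex_of_real (zig u))" for u
  define F where "F u = 1 / fst (r (P u))" for u
  have P: "P u \<in> ray (\<lambda>u. of_real (zig u))" if "u \<ge> 1" for u
    using zigzag.ray_point[OF that] by (simp add: P_def)
  have rP: "fst (r (P u)) > 0" "snd (r (P u)) = cis (F u)" if "u \<ge> 1" for u
    using r(2) P[OF that] spiral.fst_ray[of "r (P u)"] by (auto simp: F_def)
  have contP: "continuous_on {1..} (\<lambda>u. r (P u))"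
    unfolding P_def
    by (rule continuous_on_compose2[OF r(1) zigzag.continuous_on_ray_param])
      (use P in \<open>auto simp: P_def\<close>)
  have contF: "continuous_on {1..} F"
    unfolding F_def using rP(1) by (intro continuous_intros contP) force
  define g where "g s = snd (r (0, complex_of_real s))" for s
  have in_rem: "(0, complex_of_real s) \<in> remainder (of_real ` {-1..1})" if "s \<in> {-1..1}" for s
    using that by (simp add: remainder_def)
  have g1: "norm (g s) = 1" if "s \<in> {-1..1}" for s
    using r(3) in_rem[OF that] by (force simp: g_def remainder_def)
  have contg: "continuous_on {-1..1} g"
    unfolding g_def
    by (intro continuous_on_snd continuous_on_compose2[OF r(1)] continuous_intros)
      (use in_rem in auto)
  obtain \<gamma> where \<gamma>: "continuous_on {-1..1} \<gamma>" "\<And>s. s \<in> {-1..1} \<Longrightarrow> g s = exp (\<gamma> s)"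
  proof (rule continuous_logarithm_on_contractible[OF contg])
    show "contractible {-1..1::real}"
      by (simp add: convex_imp_contractible)
    show "g s \<noteq> 0" if "s \<in> {-1..1}" for s
      using g1[OF that] by auto
  qed blast
  define a where "a s = Im (\<gamma> s)" for s
  have ga: "g s = cis (a s)" if "s \<in> {-1..1}" for s
  proof -
    have "exp (Re (\<gamma> s)) = 1"
      using g1[OF that] \<gamma>(2)[OF that] by (simp add: norm_exp_eq_Re)
    then show ?thesis
      using \<gamma>(2)[OF that] by (simp add: a_def exp_eq_polar)
  qed
  have conta: "continuous_on {-1..1} a"
    unfolding a_def by (intro continuous_intros \<gamma>(1))
  then have "bounded (a ` {-1..1})"
    by (intro compact_imp_bounded compact_continuous_image compact_Icc)
  then obtain C where C: "\<And>s. s \<in> {-1..1} \<Longrightarrow> \<bar>a s\<bar> \<le> C"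
    unfolding bounded_iff by (metis imageI real_norm_def)
  define D where "D u = F u - a (zig u)" for u
  have contD: "continuous_on {1..} D"
    unfolding D_def
    by (intro continuous_intros contF continuous_on_compose2[OF conta]
        continuous_on_subset[OF continuous_on_zig]) (use zig_in in auto)
  obtain U where U: "U \<ge> 1" "\<And>u. u \<ge> U \<Longrightarrow> dist (r (P u)) (r (0, of_real (zig u))) < 1"
    using zigzag.map_close_to_remainder[OF r(1,3) zero_less_one] unfolding P_def by blast
  have cisD: "dist (cis (D u)) 1 < 1" if u: "u \<ge> U" for u
  proof -
    have z: "zig u \<in> {-1..1}"
      using zig_in u U(1) by simp
    have "cis (D u) - 1 = (cis (F u) - cis (a (zig u))) * cis (- a (zig u))"
      by (simp add: D_def algebra_simps cis_mult)
    then have "dist (cis (D u)) 1 = dist (cis (F u)) (cis (a (zig u)))"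
      by (simp add: dist_norm norm_mult)
    also have "\<dots> = dist (snd (r (P u))) (snd (r (0, of_real (zig u))))"
      using rP(2)[of u] ga[OF z] u U(1) by (simp add: g_def)
    also have "\<dots> < 1"
      using U(2)[OF u] dist_snd_le[of "r (P u)" "r (0, of_real (zig u))"] by simp
    finally show ?thesis .
  qed
  obtain n :: nat where n: "D U < real n"
    using reals_Archimedean2 by blast
  \<comment> \<open>an odd multiple of \<open>pi\<close>, which \<open>D\<close> cannot take as a value\<close>
  define T where "T = (2 * real n + 1) * pi"
  have "real n \<le> T"
    using pi_gt3 mult_mono[of "real n" "2 * real n + 1" 1 pi] by (simp add: T_def)
  then have T: "D U \<le> T" "T > 0"
    using n pi_gt_zero by (auto simp: T_def intro!: mult_pos_pos)
  have C0: "C \<ge> 0"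
    using C[of 0] by force
  obtain V where V: "V \<ge> 1" "\<And>u. u \<ge> V \<Longrightarrow> fst (r (P u)) < 1 / (T + C)"
  proof -
    have "0 < 1 / (T + C)"
      using T C0 by simp
    from zigzag.map_close_to_remainder[OF r(1,3) this] that show thesis
      unfolding P_def by blast
  qed
  define w where "w = max U V"
  have w: "w \<ge> U" "w \<ge> V" "w \<ge> 1"
    using U(1) by (auto simp: w_def)
  have "T + C \<le> F w"
    using V(2)[OF w(2)] rP(1)[OF w(3)] T C0 by (simp add: F_def field_simps)
  moreover have "\<bar>a (zig w)\<bar> \<le> C"
    using C zig_in w(3) by simp
  ultimately have "T \<le> D w"
    by (simp add: D_def)
  then obtain u where u: "U \<le> u" "D u = T"
    using IVT'[of D U T w] T(1) w continuous_on_subset[OF contD, of "{U..w}"] U(1) by auto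
  have "T = 2 * pi * real n + pi"
    by (simp add: T_def algebra_simps)
  then have "cis T = cis (2 * pi * real n) * cis pi"
    by (simp only: cis_mult)
  also have "cis (2 * pi * real n) = 1"
    by (rule cis_multiple_2pi) simp
  finally have "cis T = - 1"
    by simp
  then show False
    using cisD[OF u(1)] u(2) by (simp add: dist_norm)
qed

lemma zig_half_steps:
  assumes "j \<le> 2 * 2 ^ k"
  shows "zig (3 * 2 ^ k + real j / 2) = (if even j then 0 else - 1)"
proof -
  have "real j \<le> 2 * 2 ^ k"
    using assms of_nat_mono[of j "2 * 2 ^ k", where 'a = real] by simp
  then have "zig (3 * 2 ^ k + real j / 2) = bend (- frac (real j / 2))"
    by (intro zig_run) auto
  also have "frac (real j / 2) = (if even j then 0 else 1 / 2)"
  proof (cases "even j")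
    case True
    then obtain i where "j = 2 * i" by blast
    then show ?thesis by simp
  next
    case False
    then obtain i where i: "j = 2 * i + 1"
      using oddE by blast
    have "frac (real j / 2) = 1 / 2"
      unfolding frac_unique_iff using i by (simp add: add_divide_distrib)
    then show ?thesis
      using False by simp
  qed
  finally show ?thesis
    by (simp add: bend_def)
qed

lemma zig_nonpos_on_run:
  assumes "3 * 2 ^ k \<le> u" "u \<le> 4 * 2 ^ k"
  shows "zig u \<le> 0"
proof -
  have "zig (3 * 2 ^ k + (u - 3 * 2 ^ k)) = bend (- frac (u - 3 * 2 ^ k))"
    using assms by (intro zig_run) auto
  moreover have "bend (- t) \<le> 0" if "0 \<le> t" "t < 1" for t
    using that by (auto simp: bend_def)
  ultimately show ?thesis
    by (simp add: frac_lt_1)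
qed

text \<open>
  Let \<open>F u\<close> be the parameter of the image of the ray point \<open>P u\<close>. It tends to infinity, so the height \<open>zig (F v)\<close>
  is \<open>1\<close> for some late \<open>v\<close>. Full turns change \<open>P v\<close> very little, so the height remains positive after any
  number of turns. Hence \<open>F\<close> is never inside one of the runs of dips at the end of a turn and must cross each late run
  within a single turn. By uniform continuity every half dip needs a time of at least
  \<open>\<eta> / 2\<close>, so a single turn has no time for \<open>2 ^ k\<close> dips when \<open>k\<close> is large.
\<close>

lemma no_map_spiral_to_zigzag:
  fixes r :: "real \<times> complex \<Rightarrow> real \<times> complex"
  assumes r: "continuous_on (ray cis \<union> remainder (sphere 0 1)) r"
    "r ` ray cis \<subseteq> ray (\<lambda>u. of_real (zig u))"
    "r ` remainder (sphere 0 1) \<subseteq> remainder (of_real ` {-1..1})"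
  shows False
proof -
  define P where "P u = (1 / u, cis u)" for u
  define F where "F u = 1 / fst (r (P u))" for u
  have P: "P u \<in> ray cis" if "u \<ge> 1" for u
    using spiral.ray_point[OF that] by (simp add: P_def)
  have rP: "fst (r (P u)) > 0" "snd (r (P u)) = of_real (zig (F u))" if "u \<ge> 1" for u
    using r(2) P[OF that] zigzag.fst_ray[of "r (P u)"] by (auto simp: F_def)
  have contP: "continuous_on {1..} (\<lambda>u. r (P u))"
    unfolding P_def
    by (rule continuous_on_compose2[OF r(1) spiral.continuous_on_ray_param])
      (use P in \<open>auto simp: P_def\<close>)
  have contF: "continuous_on {1..} F"
    unfolding F_def using rP(1) by (intro continuous_intros contP) force
  have late: "\<exists>U\<ge>1. \<forall>u\<ge>U. F u \<ge> M" for M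
  proof -
    define M' where "M' = max 1 M"
    obtain U where U: "U \<ge> 1" "\<And>u. u \<ge> U \<Longrightarrow> fst (r (P u)) < 1 / M'"
    proof -
      have "0 < 1 / M'"
        by (simp add: M'_def)
      from spiral.map_close_to_remainder[OF r(1,3) this] that show thesis
        unfolding P_def by blast
    qed
    have "F u \<ge> M" if "u \<ge> U" for u
    proof -
      have "M' > 0"
        by (simp add: M'_def)
      moreover have "fst (r (P u)) > 0"
        using rP(1) U(1) that by simp
      ultimately have "M' \<le> F u"
        using U(2)[OF that] by (simp add: F_def field_simps)
      then show ?thesis
        by (simp add: M'_def)
    qed
    then show ?thesis using U(1) by blast
  qed
  have ivt: "\<exists>u. a \<le> u \<and> u \<le> b \<and> F u = c" if "1 \<le> a" "a \<le> b" "F a \<le> c" "c \<le> F b" for a b c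
    using IVT'[of F a c b] continuous_on_subset[OF contF, of "{a..b}"] that by auto
  have "uniformly_continuous_on (ray cis \<union> remainder (sphere 0 1)) r"
    using r(1) spiral.compact_ray_remainder compact_uniformly_continuous by blast
  then obtain \<eta> where \<eta>: "\<eta> > 0" "\<And>y z. y \<in> ray cis \<union> remainder (sphere 0 1) \<Longrightarrow>
      z \<in> ray cis \<union> remainder (sphere 0 1) \<Longrightarrow> dist z y < \<eta> \<Longrightarrow> dist (r z) (r y) < 1"
    unfolding uniformly_continuous_on_def by (meson zero_less_one)
  have step: "\<bar>zig (F u) - zig (F v)\<bar> < 1" if "u \<ge> 1" "v \<ge> 1" "dist (P u) (P v) < \<eta>" for u v
  proof -
    have "dist (complex_of_real (zig (F u))) (of_real (zig (F v))) < 1"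
      using \<eta>(2)[of "P v" "P u"] P that rP(2) dist_snd_le[of "r (P u)" "r (P v)"] by fastforce
    then show ?thesis
      by (simp add: dist_of_real dist_real_def)
  qed
  have distP: "dist (P u) (P v) \<le> \<bar>1 / u - 1 / v\<bar> + dist (cis u) (cis v)" for u v
    unfolding P_def dist_Pair_Pair dist_real_def by (rule sqrt_sum_squares_le_sum) auto
  obtain v where v: "v \<ge> 1" "1 / v < \<eta>" "zig (F v) = 1"
  proof -
    define u0 where "u0 = max 1 (2 / \<eta>)"
    obtain c where c: "c \<ge> F u0" "zig c = 1"
      using zig_arbitrarily_late[of 1] by auto
    obtain U where U: "\<And>u. u \<ge> U \<Longrightarrow> F u \<ge> c"
      using late by blast
    obtain v where v: "u0 \<le> v" "F v = c"
      using ivt[of u0 "max u0 U" c] U[of "max u0 U"] c(1) by (auto simp: u0_def)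
    have "v \<ge> 1" "v \<ge> 2 / \<eta>"
      using v(1) by (auto simp: u0_def)
    moreover from this have "2 \<le> v * \<eta>"
      using \<eta>(1) by (simp add: field_simps)
    then have "1 / v < \<eta>"
      using \<open>v \<ge> 1\<close> by (simp add: field_simps)
    ultimately show thesis
      using that v(2) c(2) by blast
  qed
  define \<theta> where "\<theta> m = v + 2 * pi * real m" for m
  have \<theta>v: "v \<le> \<theta> m" for m
    by (simp add: \<theta>_def)
  have \<theta>1: "1 \<le> \<theta> m" for m
    using \<theta>v[of m] v(1) by linarith
  have \<theta>Suc: "\<theta> (Suc m) = \<theta> m + 2 * pi" for m
    by (simp add: \<theta>_def algebra_simps)
  have pos: "zig (F (\<theta> m)) > 0" for m
  proof -
    have "cis (2 * pi * real m) = 1"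
      by (rule cis_multiple_2pi) simp
    then have "cis (\<theta> m) = cis v"
      by (simp add: \<theta>_def cis_mult[symmetric])
    moreover have "0 < 1 / \<theta> m" "1 / \<theta> m \<le> 1 / v"
      using \<theta>v[of m] v(1) by (simp_all add: frac_le)
    moreover from this have "\<bar>1 / \<theta> m - 1 / v\<bar> < \<eta>"
      using v(2) by linarith
    ultimately have "dist (P (\<theta> m)) (P v) < \<eta>"
      using distP[of "\<theta> m" v] by simp
    then show ?thesis
      using step[of "\<theta> m" v] \<theta>1 v by (simp add: abs_less_iff)
  qed
  obtain k where k: "F v + 4 * pi / \<eta> < 2 ^ k"
    using real_arch_pow[of 2] by auto
  have Fv: "F v > 0"
    using rP(1)[OF v(1)] by (simp add: F_def)
  have "4 * pi / \<eta> > 0"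
    using \<eta>(1) by simp
  then have k': "F v < 2 ^ k" "4 * pi / \<eta> < 2 ^ k"
    using k Fv by linarith+
  then have k1: "F (\<theta> 0) < 3 * 2 ^ k"
    using Fv by (simp add: \<theta>_def)
  have k2: "4 * pi < 2 ^ k * \<eta>"
    using k'(2) \<eta>(1) by (simp add: field_simps)
  \<comment> \<open>the first turn whose end lies beyond the beginning of the run\<close>
  define m where "m = (LEAST m. F (\<theta> m) \<ge> 3 * 2 ^ k)"
  have "\<exists>m. F (\<theta> m) \<ge> 3 * 2 ^ k"
  proof -
    obtain U where U: "\<And>u. u \<ge> U \<Longrightarrow> F u \<ge> 3 * 2 ^ k"
      using late by blast
    obtain m :: nat where "real m > U"
      using reals_Archimedean2 by blast
    moreover have "real m \<le> \<theta> m"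
    proof -
      have "1 * real m \<le> 2 * pi * real m"
        using pi_gt3 by (intro mult_right_mono) auto
      then show ?thesis
        using v(1) by (simp add: \<theta>_def)
    qed
    ultimately show ?thesis
      using U[of "\<theta> m"] by auto
  qed
  then have m: "F (\<theta> m) \<ge> 3 * 2 ^ k"
    unfolding m_def by (rule LeastI_ex)
  then have "m \<noteq> 0"
    using k1 by (cases m) auto
  then obtain l where l: "m = Suc l"
    using not0_implies_Suc by blast
  have Fl: "F (\<theta> l) < 3 * 2 ^ k"
    using not_less_Least[of l "\<lambda>m. F (\<theta> m) \<ge> 3 * 2 ^ k"] l unfolding m_def[symmetric] by simp
  have Fm: "F (\<theta> m) > 4 * 2 ^ k"
    using zig_nonpos_on_run[OF m] pos[of m] by linarith
  have chain: "\<exists>u. \<theta> l + real j * (\<eta> / 2) \<le> u \<and> u \<le> \<theta> m \<and> F u = 3 * 2 ^ k + real j / 2"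
    if "j \<le> 2 * 2 ^ k" for j
    using that
  proof (induction j)
    case 0
    show ?case
      using ivt[of "\<theta> l" "\<theta> m" "3 * 2 ^ k"] \<theta>1[of l] \<theta>Suc[of l] Fl m by (simp add: l)
  next
    case (Suc j)
    then obtain u where u: "\<theta> l + real j * (\<eta> / 2) \<le> u" "u \<le> \<theta> m" "F u = 3 * 2 ^ k + real j / 2"
      by auto
    have "real (Suc j) \<le> 2 * 2 ^ k"
      using Suc.prems of_nat_mono[of "Suc j" "2 * 2 ^ k", where 'a = real] by simp
    then have "real (Suc j) / 2 \<le> 2 ^ k"
      by simp
    then have "3 * 2 ^ k + real (Suc j) / 2 \<le> F (\<theta> m)"
      using Fm unfolding of_nat_Suc by linarith
    moreover have "0 \<le> real j * (\<eta> / 2)"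
      using \<eta>(1) by simp
    then have "u \<ge> 1"
      using u(1) \<theta>1[of l] by linarith
    ultimately obtain w where w: "u \<le> w" "w \<le> \<theta> m" "F w = 3 * 2 ^ k + real (Suc j) / 2"
      using ivt[of u "\<theta> m" "3 * 2 ^ k + real (Suc j) / 2"] u by auto
    have "\<bar>zig (F u) - zig (F w)\<bar> = 1"
      unfolding u(3) w(3) using Suc.prems by (subst (1 2) zig_half_steps) auto
    then have "\<eta> \<le> dist (P u) (P w)"
      using step[of u w] \<open>u \<ge> 1\<close> w(1) by force
    also have "\<dots> \<le> \<bar>1 / u - 1 / w\<bar> + dist (cis u) (cis w)"
      by (rule distP)
    also have "\<dots> \<le> (w - u) + (w - u)"
    proof (rule add_mono)
      have "1 / u - 1 / w = (w - u) / (u * w)"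
        using \<open>u \<ge> 1\<close> w(1) by (simp add: field_simps)
      also have "\<dots> \<le> (w - u) / 1"
        using \<open>u \<ge> 1\<close> w(1) mult_mono[of 1 u 1 w] by (intro divide_left_mono) auto
      finally have "1 / u - 1 / w \<le> w - u"
        by simp
      moreover have "1 / w \<le> 1 / u"
        using \<open>u \<ge> 1\<close> w(1) by (simp add: frac_le)
      ultimately show "\<bar>1 / u - 1 / w\<bar> \<le> w - u"
        by simp
      show "dist (cis u) (cis w) \<le> w - u"
        using dist_cis_le[of u w] w(1) by simp
    qed
    finally have "\<theta> l + real (Suc j) * (\<eta> / 2) \<le> w"
      using u(1) by (simp add: algebra_simps add_divide_distrib)
    then show ?case
      using w by blast
  qed
  from chain[of "2 * 2 ^ k"] have "\<theta> l + 2 ^ k * \<eta> \<le> \<theta> m"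
    by auto
  then show False
    using k2 \<theta>Suc[of l] pi_gt_zero by (simp add: l)
qed

section \<open>A product without the AF-property\<close>

lemma (in recurrent_ray) clopen_Times_point:
  assumes "openin (top_of_set Y) {p}" "closedin (top_of_set Y) {p}"
  shows "openin (top_of_set (pointed_space h B \<times> Y)) ((ray h \<union> remainder B) \<times> {p})"
    "closedin (top_of_set (pointed_space h B \<times> Y)) ((ray h \<union> remainder B) \<times> {p})"
    "openin (top_of_set (Y \<times> pointed_space h B)) ({p} \<times> (ray h \<union> remainder B))"
    "closedin (top_of_set (Y \<times> pointed_space h B)) ({p} \<times> (ray h \<union> remainder B))"
  using assms clopen_ray_remainder
  by (auto simp: prod_topology_subtopology_eu[symmetric] openin_prod_Times_iff closedin_prod_Times_iff
      simp del: prod_topology_subtopology_eu)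

abbreviation spiral_space :: "(real \<times> complex) set" where
  "spiral_space \<equiv> pointed_space cis (sphere 0 1)"

abbreviation zigzag_space :: "(real \<times> complex) set" where
  "zigzag_space \<equiv> pointed_space (\<lambda>u. of_real (zig u)) (of_real ` {-1..1})"

text \<open>
  The closed set that is not a limit set is the union of the two remainders, each placed in the clopen
  copy of its ray compactification over the isolated point of the other factor.
\<close>

lemma not_AF_property_product: "\<not> AF_property (top_of_set (spiral_space \<times> zigzag_space))"
proof
  assume AF: "AF_property (top_of_set (spiral_space \<times> zigzag_space))"
  define p :: "real \<times> complex" where "p = (2, 0)"
  define Z where "Z = spiral_space \<times> zigzag_space"
  define S1 where "S1 = (\<lambda>y. (y, p)) ` ray cis"
  define R1 where "R1 = (\<lambda>y. (y, p)) ` remainder (sphere 0 1)"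
  define S2 where "S2 = (\<lambda>y. (p, y)) ` ray (\<lambda>u. of_real (zig u))"
  define R2 where "R2 = (\<lambda>y. (p, y)) ` remainder (of_real ` {-1..1})"
  have C1_eq: "S1 \<union> R1 = (ray cis \<union> remainder (sphere 0 1)) \<times> {p}"
    by (auto simp: S1_def R1_def)
  have C2_eq: "S2 \<union> R2 = {p} \<times> (ray (\<lambda>u. of_real (zig u)) \<union> remainder (of_real ` {-1..1}))"
    by (auto simp: S2_def R2_def)
  have st1: "stratified S1 R1"
    unfolding S1_def R1_def
    by (rule stratified_isometric_image[OF spiral.stratified_ray_remainder]) (simp add: dist_Pair_Pair)
  have st2: "stratified S2 R2"
    unfolding S2_def R2_def
    by (rule stratified_isometric_image[OF zigzag.stratified_ray_remainder]) (simp add: dist_Pair_Pair)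
  have C1: "openin (top_of_set Z) (S1 \<union> R1)" "closedin (top_of_set Z) (S1 \<union> R1)"
    unfolding C1_eq Z_def p_def
    by (rule spiral.clopen_Times_point(1,2)[OF zigzag.clopen_isolated_point])+
  have C2: "openin (top_of_set Z) (S2 \<union> R2)" "closedin (top_of_set Z) (S2 \<union> R2)"
    unfolding C2_eq Z_def p_def
    by (rule zigzag.clopen_Times_point(3,4)[OF spiral.clopen_isolated_point])+
  have disj: "(S1 \<union> R1) \<inter> (S2 \<union> R2) = {}"
    unfolding C1_eq C2_eq p_def using spiral.isolated_point_notin by blast
  have no12: "\<nexists>r. continuous_on (S1 \<union> R1) r \<and> r ` S1 \<subseteq> S2 \<and> r ` R1 \<subseteq> R2"
  proof (intro notI, elim exE conjE, rule no_map_spiral_to_zigzag)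
    fix r assume r: "continuous_on (S1 \<union> R1) r" "r ` S1 \<subseteq> S2" "r ` R1 \<subseteq> R2"
    have "continuous_on (ray cis \<union> remainder (sphere 0 1)) (\<lambda>y. r (y, p))"
      by (rule continuous_on_compose2[OF r(1)]) (auto simp: C1_eq intro!: continuous_intros)
    then show "continuous_on (ray cis \<union> remainder (sphere 0 1)) (\<lambda>y. snd (r (y, p)))"
      by (rule continuous_on_snd)
    show "(\<lambda>y. snd (r (y, p))) ` ray cis \<subseteq> ray (\<lambda>u. of_real (zig u))"
      using r(2) by (force simp: S1_def S2_def)
    show "(\<lambda>y. snd (r (y, p))) ` remainder (sphere 0 1) \<subseteq> remainder (of_real ` {-1..1})"
      using r(3) by (force simp: R1_def R2_def)
  qed
  have no21: "\<nexists>r. continuous_on (S2 \<union> R2) r \<and> r ` S2 \<subseteq> S1 \<and> r ` R2 \<subseteq> R1"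
  proof (intro notI, elim exE conjE, rule no_map_zigzag_to_spiral)
    fix r assume r: "continuous_on (S2 \<union> R2) r" "r ` S2 \<subseteq> S1" "r ` R2 \<subseteq> R1"
    have "continuous_on (ray (\<lambda>u. of_real (zig u)) \<union> remainder (of_real ` {-1..1})) (\<lambda>y. r (p, y))"
      by (rule continuous_on_compose2[OF r(1)]) (auto simp: C2_eq intro!: continuous_intros)
    then show "continuous_on (ray (\<lambda>u. of_real (zig u)) \<union> remainder (of_real ` {-1..1}))
        (\<lambda>y. fst (r (p, y)))"
      by (rule continuous_on_fst)
    show "(\<lambda>y. fst (r (p, y))) ` ray (\<lambda>u. of_real (zig u)) \<subseteq> ray cis"
      using r(2) by (force simp: S1_def S2_def)
    show "(\<lambda>y. fst (r (p, y))) ` remainder (of_real ` {-1..1}) \<subseteq> remainder (sphere 0 1)"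
      using r(3) by (force simp: R1_def R2_def)
  qed
  have "compact (remainder (sphere 0 1))" "compact (remainder (of_real ` {-1..1}))"
    unfolding remainder_def using spiral.compact_B zigzag.compact_B by (simp_all add: compact_Times)
  then have "compact (R1 \<union> R2)"
    unfolding R1_def R2_def by (intro compact_Un compact_continuous_image continuous_intros)
  moreover have "R1 \<union> R2 \<subseteq> Z"
    using C1(2) C2(2) closedin_imp_subset by blast
  ultimately have "closedin (top_of_set Z) (R1 \<union> R2)"
    by (simp add: closed_subset compact_imp_closed)
  then have "is_alpha_limit_set (top_of_set Z) (R1 \<union> R2)"
    using AF unfolding AF_property_iff Z_def by blast
  then obtain f x where f: "continuous_map (top_of_set Z) (top_of_set Z) f"
      "R1 \<union> R2 = alpha_limit (top_of_set Z) f x"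
    unfolding is_alpha_limit_set_def by blast
  have "continuous_on Z f" "f ` Z \<subseteq> Z"
    using f(1) by auto
  from alpha_limit_not_both_remainders[OF this st1 st2 C1 C2 disj no12 no21] show False
    using f(2)[symmetric] by blast
qed

theorem theorem21:
  "\<exists>(X :: (nat \<Rightarrow> real) topology) (Y :: (nat \<Rightarrow> real) topology).
     compact_space X \<and> metrizable_space X \<and> AF_property X \<and>
     compact_space Y \<and> metrizable_space Y \<and> AF_property Y \<and>
     \<not> AF_property (prod_topology X Y)"
proof -
  obtain S T :: "(nat \<Rightarrow> real) set" where
    S: "compact S" "top_of_set spiral_space homeomorphic_space top_of_set S" and
    T: "compact T" "top_of_set zigzag_space homeomorphic_space top_of_set T"
    using homeomorphic_copy_in_sequences spiral.compact_pointed_space zigzag.compact_pointed_space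
    by metis
  have "prod_topology (top_of_set spiral_space) (top_of_set zigzag_space)
      homeomorphic_space prod_topology (top_of_set S) (top_of_set T)"
    using S(2) T(2) by (rule homeomorphic_space_prod_topology)
  then have "prod_topology (top_of_set S) (top_of_set T)
      homeomorphic_space top_of_set (spiral_space \<times> zigzag_space)"
    unfolding prod_topology_subtopology_eu by (rule homeomorphic_space_sym[THEN iffD1])
  then have "\<not> AF_property (prod_topology (top_of_set S) (top_of_set T))"
    using AF_property_homeomorphic_space not_AF_property_product by blast
  moreover have "AF_property (top_of_set S)" "AF_property (top_of_set T)"
    using AF_property_homeomorphic_space[OF S(2) spiral.AF_property_pointed_space]
      AF_property_homeomorphic_space[OF T(2) zigzag.AF_property_pointed_space] .
  moreover have "metrizable_space (top_of_set U)" for U :: "(nat \<Rightarrow> real) set"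
    by (intro metrizable_space_subtopology metrizable_space_euclidean)
  ultimately show ?thesis
    using S(1) T(1) by (intro exI[of _ "top_of_set S"] exI[of _ "top_of_set T"])
      (simp add: compact_space_subtopology)
qed

end
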